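(* With the operator $Z$ and the vectors $|e_n\rangle,|e_n^*\rangle,|d_n\rangle,|d_n^*\rangle$ of $\mathcal V_N$ defined in the context, set $U_m(n):=\langle e_m|d_n^*\rangle$ and $\tilde U_m(n):=\langle e_m^*|Z|d_n\rangle$, and let $$a=\alpha-\beta,\qquad b=N-2\beta-1.$$ Assume no denominator appearing below or in the context vanishes. Then for all $m,n=0,1,\dots,N$, $$U_m(n)=\frac{a_0\cdots a_{n-1}}{a_0\cdots a_{m-1}}\,q^{(a+m-N-1)m}\,\frac{(q^{1-a};q)_n(q^{1+b};q)_m}{(q;q)_n(q^{m+b-N};q)_m}\,\mathcal U_m(n;a,b,N;q),$$ $$\tilde U_m(n)=-\frac{a_n\cdots a_{N-1}}{a_m\cdots a_{N-1}}\,q^{(a-b-m-1)(N-m)+(b-a+1)(N-n)}\,\frac{(q^{m+1};q)_{N-m}(q^{a-b-1};q)_{N-n}}{(q;q)_{N-n}(q^{-N};q)_m(q^{-b};q)_{N-2m}}\,\mathcal V_m(n;a,b,N;q),$$ where $\mathcal U_m,\mathcal V_m$ are the rational functions of $q$-Hahn type.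
   Context: $q$ is real, $q>0$, $q\ne1$; $[x]_q=\frac{1-q^x}{1-q}$; $(a;q)_0=1$, $(a;q)_k=\prod_{i=0}^{k-1}(1-aq^i)$ for $k\ge1$, and for negative index $(a;q)_{-k}=1/(aq^{-k};q)_k$. $N$ is a positive integer, $\alpha,\beta$ are real parameters, $a_0,\dots,a_{N-1}$ are nonzero real constants (not to be confused with the parameter $a$), $a_N=0$. Empty products equal $1$. The rational functions of $q$-Hahn type are, for $m=0,\dots,N$, $$\mathcal U_m(x;a,b,N;q)=q^{m(N-m-b)}\frac{(q^{-N};q)_m}{(q^{-m-b};q)_m}\sum_{k=0}^m\frac{(q^{-m};q)_k(q^{-x};q)_k(q^{b+m-N};q)_k}{(q^{-N};q)_k(q^{a-x};q)_k}\frac{q^k}{(q;q)_k},$$ $$\mathcal V_m(x;a,b,N;q)=\mathcal U_m(N-x;b-a+2,b,N;q^{-1}),$$ where in the second line $q$ is replaced by $q^{-1}$ everywhere in the definition of $\mathcal U_m$. $\mathcal V_N$ is a real $(N+1)$-dimensional vector space with scalar product $\langle v|w\rangle$ and orthonormal basis $\{|n\rangle\}_{n=0}^N$. The operator $Z$ acts by $Z|n\rangle=-|n\rangle+a_n|n+1\rangle$ (no $|N+1\rangle$ term). For $n=0,\dots,N$ define $$|e_n\rangle=\sum_{\ell=0}^N\frac{a_0\cdots a_{\ell-1}}{a_0\cdots a_{n-1}}\frac{q^{(\alpha-\beta-1)n}}{q^{(\alpha-\beta-1)\ell}}\frac{(q^{-n};q)_\ell}{(q^{-n};q)_n}\frac{(q;q)_n}{(q;q)_\ell}\frac{(q^{-N};q)_n}{(q^{-N};q)_\ell}\frac{(q^{n-2\beta-1};q)_\ell}{(q^{n-2\beta-1};q)_n}|\ell\rangle,$$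 $$|e_n^*\rangle=\sum_{\ell=0}^N\frac{a_\ell\cdots a_{N-1}}{a_n\cdots a_{N-1}}\frac{q^{(\alpha+\beta-N)(N-n)}}{q^{(\alpha+\beta-N)(N-\ell)}}\frac{(q^{n-N};q)_{N-\ell}}{(q^{n-N};q)_{N-n}}\frac{(q;q)_{N-n}}{(q;q)_{N-\ell}}\frac{(q^{-N};q)_{N-n}}{(q^{-N};q)_{N-\ell}}\frac{(q^{-N-n+2\beta+1};q)_{N-\ell}}{(q^{-N-n+2\beta+1};q)_{N-n}}|\ell\rangle,$$ $$|d_n\rangle=\sum_{\ell=0}^N\frac{a_n\cdots a_{N-1}}{a_\ell\cdots a_{N-1}}\frac{(q^{n-N};q)_{N-\ell}}{(q^{n-N};q)_{N-n}}\frac{(q^{n-N-\alpha+\beta+1};q)_{N-n}}{(q^{n-N-\alpha+\beta+1};q)_{N-\ell}}|\ell\rangle,$$ $$|d_n^*\rangle=\sum_{\ell=0}^N\frac{a_0\cdots a_{n-1}}{a_0\cdots a_{\ell-1}}\frac{q^{(\beta-\alpha)n}}{q^{(\beta-\alpha)\ell}}\frac{(q^{-n};q)_\ell}{(q^{-n};q)_n}\frac{(q^{-n+\alpha-\beta};q)_n}{(q^{-n+\alpha-\beta};q)_\ell}|\ell\rangle.$$ With the further operators $X|n\rangle=-[\alpha-n]_q|n\rangle+a_n[\beta-n]_q|n+1\rangle$ and $V|n\rangle=[n-\beta]_q[\beta-n+1]_q|n\rangle-\frac{q^{\alpha-N}[n]_q[N+1-n]_q}{a_{n-1}}|n-1\rangle$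 (no out-of-range terms), $|e_n\rangle,|e_n^*\rangle$ are eigenvectors of $V,V^\top$ with eigenvalue $[n-\beta]_q[\beta-n+1]_q$, and $|d_n\rangle,|d_n^*\rangle$ solve $X|d_n\rangle=[\alpha-n]_qZ|d_n\rangle$, $X^\top|d_n^*\rangle=[\alpha-n]_qZ^\top|d_n^*\rangle$; all are normalized so that the coefficient of $|n\rangle$ is $1$. *)

theory Defs
  imports "HOL-Analysis.Analysis"
begin

definition qpoch :: "real \<Rightarrow> real \<Rightarrow> nat \<Rightarrow> real" where
  "qpoch c q k = (\<Prod>i<k. 1 - c * q ^ i)"

text \<open>Integer index, with the convention that the value at index $-k$ is
  $1/(c q^{-k};q)_k$. Since \<open>1 / 0 = 0\<close>, the condition \<open>qpoch_int c q k \<noteq> 0\<close> for negative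
  \<open>k\<close> also says that the denominator in this convention does not vanish.\<close>

definition qpoch_int :: "real \<Rightarrow> real \<Rightarrow> int \<Rightarrow> real" where
  "qpoch_int c q k =
     (if 0 \<le> k then qpoch c q (nat k)
      else 1 / qpoch (c * q powi k) q (nat (- k)))"

definition qHahn_U :: "nat \<Rightarrow> real \<Rightarrow> real \<Rightarrow> real \<Rightarrow> nat \<Rightarrow> real \<Rightarrow> real" where
  "qHahn_U m x a b N q =
     q powr (real m * (real N - real m - b))
     * (qpoch (q powr (- real N)) q m / qpoch (q powr (- real m - b)) q m)
     * (\<Sum>k\<le>m. (qpoch (q powr (- real m)) q k * qpoch (q powr (- x)) q k
                   * qpoch (q powr (b + real m - real N)) q k)
                / (qpoch (q powr (- real N)) q k * qpoch (q powr (a - x)) q k)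
                * (q ^ k / qpoch q q k))"

definition qHahn_V :: "nat \<Rightarrow> real \<Rightarrow> real \<Rightarrow> real \<Rightarrow> nat \<Rightarrow> real \<Rightarrow> real" where
  "qHahn_V m x a b N q = qHahn_U m (real N - x) (b - a + 2) b N (inverse q)"

text \<open>In the vectors below, \<open>A i\<close> is the constant $a_i$ and \<open>ket n\<close> is the basis vector
  $|n\rangle$.\<close>

definition vec_e ::
  "real \<Rightarrow> real \<Rightarrow> real \<Rightarrow> nat \<Rightarrow> (nat \<Rightarrow> real) \<Rightarrow> (nat \<Rightarrow> 'v::real_vector) \<Rightarrow> nat \<Rightarrow> 'v"
where
  "vec_e q \<alpha> \<beta> N A ket n = (\<Sum>l\<le>N.
     (((\<Prod>i<l. A i) / (\<Prod>i<n. A i))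
      * (q powr ((\<alpha> - \<beta> - 1) * real n) / q powr ((\<alpha> - \<beta> - 1) * real l))
      * (qpoch (q powr (- real n)) q l / qpoch (q powr (- real n)) q n)
      * (qpoch q q n / qpoch q q l)
      * (qpoch (q powr (- real N)) q n / qpoch (q powr (- real N)) q l)
      * (qpoch (q powr (real n - 2 * \<beta> - 1)) q l / qpoch (q powr (real n - 2 * \<beta> - 1)) q n))
     *\<^sub>R ket l)"

definition vec_e_star ::
  "real \<Rightarrow> real \<Rightarrow> real \<Rightarrow> nat \<Rightarrow> (nat \<Rightarrow> real) \<Rightarrow> (nat \<Rightarrow> 'v::real_vector) \<Rightarrow> nat \<Rightarrow> 'v"
where
  "vec_e_star q \<alpha> \<beta> N A ket n = (\<Sum>l\<le>N.
     (((\<Prod>i\<in>{l..<N}. A i) / (\<Prod>i\<in>{n..<N}. A i))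
      * (q powr ((\<alpha> + \<beta> - real N) * (real N - real n))
         / q powr ((\<alpha> + \<beta> - real N) * (real N - real l)))
      * (qpoch (q powr (real n - real N)) q (N - l) / qpoch (q powr (real n - real N)) q (N - n))
      * (qpoch q q (N - n) / qpoch q q (N - l))
      * (qpoch (q powr (- real N)) q (N - n) / qpoch (q powr (- real N)) q (N - l))
      * (qpoch (q powr (- real N - real n + 2 * \<beta> + 1)) q (N - l)
         / qpoch (q powr (- real N - real n + 2 * \<beta> + 1)) q (N - n)))
     *\<^sub>R ket l)"

definition vec_d ::
  "real \<Rightarrow> real \<Rightarrow> real \<Rightarrow> nat \<Rightarrow> (nat \<Rightarrow> real) \<Rightarrow> (nat \<Rightarrow> 'v::real_vector) \<Rightarrow> nat \<Rightarrow> 'v"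
where
  "vec_d q \<alpha> \<beta> N A ket n = (\<Sum>l\<le>N.
     (((\<Prod>i\<in>{n..<N}. A i) / (\<Prod>i\<in>{l..<N}. A i))
      * (qpoch (q powr (real n - real N)) q (N - l) / qpoch (q powr (real n - real N)) q (N - n))
      * (qpoch (q powr (real n - real N - \<alpha> + \<beta> + 1)) q (N - n)
         / qpoch (q powr (real n - real N - \<alpha> + \<beta> + 1)) q (N - l)))
     *\<^sub>R ket l)"

definition vec_d_star ::
  "real \<Rightarrow> real \<Rightarrow> real \<Rightarrow> nat \<Rightarrow> (nat \<Rightarrow> real) \<Rightarrow> (nat \<Rightarrow> 'v::real_vector) \<Rightarrow> nat \<Rightarrow> 'v"
where
  "vec_d_star q \<alpha> \<beta> N A ket n = (\<Sum>l\<le>N.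
     (((\<Prod>i<n. A i) / (\<Prod>i<l. A i))
      * (q powr ((\<beta> - \<alpha>) * real n) / q powr ((\<beta> - \<alpha>) * real l))
      * (qpoch (q powr (- real n)) q l / qpoch (q powr (- real n)) q n)
      * (qpoch (q powr (- real n + \<alpha> - \<beta>)) q n / qpoch (q powr (- real n + \<alpha> - \<beta>)) q l))
     *\<^sub>R ket l)"

text \<open>The denominators that can vanish. The remaining ones are powers of \<open>q\<close>, products of the
  nonzero constants $a_i$, and factors $(q;q)_k$, $(q^{-r};q)_k$ with $k \le r$ or their
  analogues in base $q^{-1}$; they are nonzero for every $q > 0$, $q \ne 1$.\<close>

definition qHahn_U_denominators_nonzero ::
  "nat \<Rightarrow> real \<Rightarrow> real \<Rightarrow> real \<Rightarrow> real \<Rightarrow> bool"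
where
  "qHahn_U_denominators_nonzero m x a b q \<longleftrightarrow>
     qpoch (q powr (- real m - b)) q m \<noteq> 0 \<and>
     (\<forall>k\<le>m. qpoch (q powr (a - x)) q k \<noteq> 0)"

definition vec_denominators_nonzero :: "real \<Rightarrow> real \<Rightarrow> real \<Rightarrow> nat \<Rightarrow> bool" where
  "vec_denominators_nonzero q \<alpha> \<beta> N \<longleftrightarrow>
     (\<forall>n\<le>N.
        qpoch (q powr (real n - 2 * \<beta> - 1)) q n \<noteq> 0 \<and>
        qpoch (q powr (- real N - real n + 2 * \<beta> + 1)) q (N - n) \<noteq> 0 \<and>
        (\<forall>l\<le>N. qpoch (q powr (real n - real N - \<alpha> + \<beta> + 1)) q (N - l) \<noteq> 0 \<and>
                qpoch (q powr (- real n + \<alpha> - \<beta>)) q l \<noteq> 0))"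

end

theory Submission
  imports Defs
begin

text \<open>
  Expanded in the orthonormal basis, $\langle e_m|d_n^*\rangle$ agrees term by term with the sum
  defining $\mathcal U_m$, and only the prefactors have to be compared. For the second formula,
  $Z|d_n\rangle$ has coefficients that are differences of consecutive ratios
  $(q^{n-N};q)_j/(c;q)_j$ with $c = q^{n-N-a+1}$, which collapse to single ratios over $(cq;q)_j$.
  The scalar product is then a terminating ${}_3\phi_2$ series, and the one defining $\mathcal V_m$,
  rewritten in base $q$, is its image under the transformation
  \[ {}_3\phi_2(q^{-n},\beta,\gamma;\delta,\epsilon;q,\delta\epsilon q^n/\beta\gamma)
    = \frac{(\delta\epsilon/\beta\gamma;q)_n}{(\epsilon;q)_n}\,
      {}_3\phi_2(q^{-n},\delta/\beta,\delta/\gamma;\delta,\delta\epsilon/\beta\gamma;q,\epsilon q^n). \]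
\<close>

section \<open>Elementary properties of q-shifted factorials\<close>

lemma qpoch_0 [simp]: "qpoch c q 0 = 1"
  by (simp add: qpoch_def)

lemma qpoch_Suc: "qpoch c q (Suc k) = qpoch c q k * (1 - c * q ^ k)"
  by (simp add: qpoch_def)

lemma qpoch_add: "qpoch c q (m + n) = qpoch c q m * qpoch (c * q ^ m) q n"
  by (induction n) (simp_all add: qpoch_Suc power_add mult.assoc)

lemma qpoch_Suc_left: "qpoch c q (Suc k) = (1 - c) * qpoch (c * q) q k"
  using qpoch_add[of c q 1 k] by (simp add: qpoch_Suc)

lemma qpoch_eq_0_iff: "qpoch c q k = 0 \<longleftrightarrow> (\<exists>i<k. c * q ^ i = 1)"
  by (auto simp: qpoch_def)

lemma power_neq_1:
  fixes q :: real
  assumes "q > 0" "q \<noteq> 1" "n > 0"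
  shows "q ^ n \<noteq> 1"
  using power_eq_iff_eq_base[of n q 1] assms by simp

lemma qpoch_q_neq_0:
  assumes "q > 0" "q \<noteq> 1"
  shows "qpoch q q k \<noteq> 0"
  using power_neq_1[OF assms, of "Suc _"] by (auto simp: qpoch_eq_0_iff)

text \<open>The factor with index \<open>n\<close> is 1 - q^(-n) q^n = 0. This terminates the series
  below and allows their summation ranges to be changed.\<close>

lemma qpoch_inverse_power_eq_0:
  assumes "q > 0" "n < k"
  shows "qpoch (1 / q ^ n) q k = 0"
  using assms by (auto simp: qpoch_eq_0_iff intro!: exI[of _ n])

lemma qpoch_inverse_power_neq_0:
  assumes "q > 0" "q \<noteq> 1" "k \<le> n"
  shows "qpoch (1 / q ^ n) q k \<noteq> 0"
proof -
  have "q ^ i \<noteq> q ^ n" if "i < k" for i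
    using that assms power_neq_1[OF assms(1,2), of "n - i"] by (simp add: power_diff)
  then show ?thesis
    using assms by (fastforce simp: qpoch_eq_0_iff field_simps)
qed

section \<open>Gaussian binomial coefficients\<close>

text \<open>The Gaussian binomial coefficients, encoded by the q-Pascal rule so that no division
  occurs and sums over them yield to induction on \<open>n\<close>. For \<open>k > n\<close> the
  truncated exponent \<open>n - k\<close> is harmless, because the coefficient next to it is
  0.\<close>

fun qbinom :: "real \<Rightarrow> nat \<Rightarrow> nat \<Rightarrow> real" where
  "qbinom q n 0 = 1"
| "qbinom q 0 (Suc k) = 0"
| "qbinom q (Suc n) (Suc k) = qbinom q n (Suc k) + q ^ (n - k) * qbinom q n k"

lemma qbinom_eq_0: "n < k \<Longrightarrow> qbinom q n k = 0"
  by (induction q n k rule: qbinom.induct) auto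

text \<open>Both terms of the q-Pascal rule become multiples of \<open>qpoch q q n\<close>, and (1 -
  q^(n-k)) + q^(n-k) (1 - q^(k+1)) = 1 - q^(n+1).\<close>

lemma qbinom_qpoch:
  "k \<le> n \<Longrightarrow> qbinom q n k * qpoch q q k * qpoch q q (n - k) = qpoch q q n"
proof (induction q n k rule: qbinom.induct)
  case (3 q n k)
  \<comment> \<open>For \<open>k = n\<close> both sides are 0: on the left the coefficient is out of
    range, on the right 1 - q^0 = 0.\<close>
  have A: "qbinom q n (Suc k) * qpoch q q (Suc k) * qpoch q q (n - k)
      = qpoch q q n * (1 - q ^ (n - k))"
  proof (cases "k = n")
    case False
    then have k: "n - k = Suc (n - Suc k)" "Suc k \<le> n"
      using 3 by auto
    have "qbinom q n (Suc k) * qpoch q q (Suc k) * qpoch q q (n - k)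
        = (qbinom q n (Suc k) * qpoch q q (Suc k) * qpoch q q (n - Suc k)) * (1 - q ^ (n - k))"
      unfolding k(1) qpoch_Suc[of q q "n - Suc k"] by (simp add: mult.assoc)
    with 3 k show ?thesis by simp
  qed (simp add: qbinom_eq_0)
  have B: "qbinom q n k * qpoch q q (Suc k) * qpoch q q (n - k) = qpoch q q n * (1 - q ^ Suc k)"
    using 3 by (simp add: qpoch_Suc algebra_simps)
  have C: "q ^ Suc n = q ^ (n - k) * q ^ Suc k"
    using 3 by (simp flip: power_add)
  have D: "qpoch q q (Suc n) = qpoch q q n * (1 - q ^ Suc n)"
    by (simp add: qpoch_Suc)
  have "qbinom q (Suc n) (Suc k) * qpoch q q (Suc k) * qpoch q q (Suc n - Suc k)
      = qbinom q n (Suc k) * qpoch q q (Suc k) * qpoch q q (n - k)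
        + q ^ (n - k) * (qbinom q n k * qpoch q q (Suc k) * qpoch q q (n - k))"
    by (simp add: distrib_right mult.assoc)
  then show ?case
    unfolding A B C D by (simp add: algebra_simps)
qed simp_all

text \<open>The q-Pascal rule under a sum, with the index of the second part shifted. It drives the
  induction for the Vandermonde sum.\<close>

lemma sum_qbinom_Suc:
  "(\<Sum>i\<le>Suc n. qbinom q (Suc n) i * F i)
    = (\<Sum>i\<le>n. qbinom q n i * F i) + (\<Sum>i\<le>n. q ^ (n - i) * qbinom q n i * F (Suc i))"
proof -
  have "(\<Sum>i\<le>n. qbinom q n i * F i) = (\<Sum>i\<le>Suc n. qbinom q n i * F i)"
    by (simp add: qbinom_eq_0)
  also have "\<dots> = F 0 + (\<Sum>i\<le>n. qbinom q n (Suc i) * F (Suc i))"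
    by (simp add: sum.atMost_Suc_shift del: sum.atMost_Suc)
  finally show ?thesis
    by (simp add: sum.atMost_Suc_shift sum.distrib algebra_simps del: sum.atMost_Suc)
qed

text \<open>\<open>qsign q k\<close> is $(-1)^k q^{k(k-1)/2}$, the factor relating $(q^{-n};q)_k$ to
  $(q;q)_n/(q;q)_{n-k}$.\<close>

definition qsign :: "real \<Rightarrow> nat \<Rightarrow> real" where
  "qsign q k = (\<Prod>i<k. - (q ^ i))"

lemma qsign_0 [simp]: "qsign q 0 = 1"
  by (simp add: qsign_def)

lemma qsign_Suc: "qsign q (Suc k) = - (q ^ k) * qsign q k"
  by (simp add: qsign_def)

lemma qsign_neq_0: "q \<noteq> 0 \<Longrightarrow> qsign q k \<noteq> 0"
  by (simp add: qsign_def)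

lemma qsign_add: "qsign q (i + j) = qsign q i * qsign q j * q ^ (i * j)"
  by (induction j) (simp_all add: qsign_Suc power_add)

text \<open>Each factor is 1 - q^(i-n) = -q^(i-n) (1 - q^(n-i)). The signs and the q^i collect in
  \<open>qsign q k\<close>, and the factors 1 - q^(n-i) make up (q;q)_n / (q;q)_(n-k).\<close>

lemma qpoch_inverse_power:
  assumes "q > 0" "k \<le> n"
  shows "qpoch (1 / q ^ n) q k * q ^ (n * k) * qpoch q q (n - k) = qsign q k * qpoch q q n"
  using assms(2)
proof (induction k)
  case (Suc k)
  have nk: "n - k = Suc (n - Suc k)" using Suc.prems by simp
  have e: "(1 - 1 / q ^ n * q ^ k) * q ^ n = - (q ^ k) * (1 - q ^ (n - k))"
    using assms Suc.prems by (simp add: field_simps flip: power_add)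
  have "qpoch (1 / q ^ n) q (Suc k) * q ^ (n * Suc k) * qpoch q q (n - Suc k)
     = qpoch (1 / q ^ n) q k * q ^ (n * k) * qpoch q q (n - Suc k) * ((1 - 1 / q ^ n * q ^ k) * q ^ n)"
    by (simp add: qpoch_Suc power_add)
  also have "\<dots> = - (q ^ k) * (qpoch (1 / q ^ n) q k * q ^ (n * k) * qpoch q q (n - k))"
    unfolding e by (simp add: nk qpoch_Suc)
  finally show ?case using Suc by (simp add: qsign_Suc)
qed simp

text \<open>Dictionary between sums over \<open>qbinom\<close>, which suit induction, and the factor
  (q^(-n);q)_k / (q;q)_k of hypergeometric series.\<close>

lemma qbinom_qsign:
  assumes "q > 0" "q \<noteq> 1" "k \<le> n"
  shows "qbinom q n k * qsign q k = qpoch (1 / q ^ n) q k * q ^ (n * k) / qpoch q q k"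
proof -
  note nz = qpoch_q_neq_0[OF assms(1,2)]
  have "(qbinom q n k * qsign q k * qpoch q q k) * qpoch q q (n - k)
      = qsign q k * (qbinom q n k * qpoch q q k * qpoch q q (n - k))"
    by (simp add: mult_ac)
  also have "\<dots> = (qpoch (1 / q ^ n) q k * q ^ (n * k)) * qpoch q q (n - k)"
    using qpoch_inverse_power[of q k n] assms by (simp add: qbinom_qpoch)
  finally show ?thesis
    using nz[of "n - k"] nz[of k] by (simp add: eq_divide_eq)
qed

section \<open>The Vandermonde and Saalschuetz sums and the 3phi2 transformation\<close>

text \<open>The q-Chu-Vandermonde sum 2phi1(q^(-r), g; gu; q, u q^r) = (u;q)_r / (gu;q)_r, cleared
  of the denominator (gu;q)_r. In the induction the first half of the q-Pascal rule gains the factor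
  1 - g u q^r, while the second half is the same sum at \<open>g * q\<close>, which is why
  \<open>g\<close> is arbitrary. The halves combine by (1 - g u q^r) - (1 - g) u q^r = 1 - u
  q^r.\<close>

lemma q_Vandermonde:
  "(\<Sum>i\<le>r. qbinom q r i * (qsign q i * u ^ i * qpoch g q i * qpoch (g * u * q ^ i) q (r - i)))
    = qpoch u q r"
proof (induction r arbitrary: g)
  case (Suc r)
  define F where "F = (\<lambda>i. qsign q i * u ^ i * qpoch g q i * qpoch (g * u * q ^ i) q (Suc r - i))"
  have 1: "qbinom q r i * F i = (1 - g * u * q ^ r)
      * (qbinom q r i * (qsign q i * u ^ i * qpoch g q i * qpoch (g * u * q ^ i) q (r - i)))"
    if "i \<le> r" for i
    using that by (simp add: F_def Suc_diff_le qpoch_Suc mult.assoc flip: power_add)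
  have 2: "q ^ (r - i) * qbinom q r i * F (Suc i) = - ((1 - g) * q ^ r * u)
      * (qbinom q r i * (qsign q i * u ^ i * qpoch (g * q) q i * qpoch (g * q * u * q ^ i) q (r - i)))"
    if "i \<le> r" for i
  proof -
    have "q ^ (r - i) * q ^ i = q ^ r" using that by (simp flip: power_add)
    moreover have "q ^ (r - i) * qbinom q r i * F (Suc i) = - ((1 - g) * (q ^ (r - i) * q ^ i) * u)
      * (qbinom q r i * (qsign q i * u ^ i * qpoch (g * q) q i * qpoch (g * q * u * q ^ i) q (r - i)))"
      by (simp add: F_def qsign_Suc qpoch_Suc_left[of g] mult_ac)
    ultimately show ?thesis by simp
  qed
  have "(\<Sum>i\<le>r. qbinom q r i * F i) = (1 - g * u * q ^ r) * qpoch u q r"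
    unfolding Suc.IH[of g, symmetric] sum_distrib_left by (rule sum.cong) (use 1 in auto)
  moreover have "(\<Sum>i\<le>r. q ^ (r - i) * qbinom q r i * F (Suc i))
      = - ((1 - g) * q ^ r * u) * qpoch u q r"
    unfolding Suc.IH[of "g * q", symmetric] sum_distrib_left
    by (rule sum.cong[OF refl], rule 2) simp
  ultimately have "(\<Sum>i\<le>Suc r. qbinom q (Suc r) i * F i)
      = (1 - g * u * q ^ r) * qpoch u q r + - ((1 - g) * q ^ r * u) * qpoch u q r"
    unfolding sum_qbinom_Suc by simp
  also have "\<dots> = qpoch u q (Suc r)"
    by (simp add: qpoch_Suc algebra_simps)
  finally show ?case by (simp add: F_def)
qed simp

text \<open>For nonzero \<open>g\<close> this is the q-Saalschuetz sum of the balanced series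
  3phi2(q^(-k), B, C; gBC, q^(1-k)/g; q, q), multiplied by (g;q)_k / (q;q)_k. The convolution form
  in \<open>j\<close> and \<open>k - j\<close> suits the later exchange of summations.\<close>

lemma q_Saalschuetz:
  assumes q: "q > 0" "q \<noteq> 1" and d: "qpoch (g * B * C) q k \<noteq> 0"
  shows "(\<Sum>j\<le>k. qpoch B q j * qpoch C q j * qpoch g q (k - j) * g ^ j
      / (qpoch q q j * qpoch (g * B * C) q j * qpoch q q (k - j)))
    = qpoch (g * C) q k * qpoch (g * B) q k / (qpoch q q k * qpoch (g * B * C) q k)"
  using d
proof (induction k)
  case (Suc k)
  define d where "d = g * B * C"
  define t where "t = (\<lambda>k j. qpoch B q j * qpoch C q j * qpoch g q (k - j) * g ^ j
      / (qpoch q q j * qpoch d q j * qpoch q q (k - j)))"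
  \<comment> \<open>Gosper certificate: the first-order recurrence in \<open>k\<close> satisfied by the right-hand side
    holds for the summand \<open>t\<close> up to the difference \<open>G (Suc j) - G j\<close>.\<close>
  define G where "G = (\<lambda>j. if j = 0 then 0 else - (q ^ (Suc k - j)) *
      (qpoch B q j * qpoch C q j * qpoch g q (Suc k - j) * g ^ j
      / (qpoch q q (j - 1) * qpoch d q (j - 1) * qpoch q q (Suc k - j))))"
  note nq = qpoch_q_neq_0[OF q]
  have nd: "qpoch d q j \<noteq> 0" if "j \<le> Suc k" for j
    using Suc.prems that by (auto simp: d_def qpoch_eq_0_iff)
  have nd1: "1 - d * q ^ j \<noteq> 0" if "j \<le> k" for j
    using nd[of "Suc j"] that by (simp add: qpoch_Suc)
  have nq1: "1 - q * q ^ j \<noteq> 0" for j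
    using nq[of "Suc j"] by (simp add: qpoch_Suc)
  have step: "(1 - q ^ Suc k) * (1 - d * q ^ k) * t (Suc k) j
      - (1 - g * C * q ^ k) * (1 - g * B * q ^ k) * t k j = G (Suc j) - G j" if "j \<le> k" for j
  proof -
    \<comment> \<open>With x = q^j and y = q^(k-j), hence q^k = xy, the terms
      \<open>t (Suc k) j\<close>, \<open>G (Suc j)\<close> and \<open>G j\<close> are all rational
      multiples of \<open>t k j\<close>. The claim reduces to the rational identity
      \<open>key\<close>.\<close>
    define y where "y = q ^ (k - j)"
    define x where "x = q ^ j"
    have Q: "q ^ k = x * y" "q ^ (Suc k - j) = q * y" "q ^ (k - j) = y"
      using that by (simp_all add: x_def y_def Suc_diff_le flip: power_add)
    have y1: "1 - q * y \<noteq> 0" using nq1[of "k - j"] by (simp add: y_def)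
    have t1: "t (Suc k) j = t k j * ((1 - g * y) / (1 - q * y))"
      using that by (simp add: t_def Suc_diff_le qpoch_Suc y_def mult_ac)
    have G1: "G (Suc j) = - y * g * (1 - B * x) * (1 - C * x) * t k j"
      using that by (simp add: G_def t_def qpoch_Suc x_def y_def)
    \<comment> \<open>The factor \<open>1 - x\<close> vanishes at \<open>j = 0\<close>, so the
      formula also covers the value 0 set there in \<open>G\<close>.\<close>
    have G0: "G j = - q * y * ((1 - g * y) * (1 - x) * (1 - d * x / q) / (1 - q * y)) * t k j"
    proof (cases j)
      case 0
      then show ?thesis by (simp add: G_def x_def)
    next
      case (Suc i)
      have ki: "k - i = Suc (k - Suc i)"
        using that Suc by simp
      have x: "x = q * q ^ i" by (simp add: x_def Suc)
      have nz: "1 - q * q ^ i \<noteq> 0" "1 - d * q ^ i \<noteq> 0"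
        using nq1[of i] nd1[of i] that Suc by auto
      have "G j = - (q * y) * (qpoch B q j * qpoch C q j * (qpoch g q (k - j) * (1 - g * y)) * g ^ j
      / (qpoch q q i * qpoch d q i * (qpoch q q (k - j) * (1 - q * y))))"
        using that Suc ki by (simp add: G_def qpoch_Suc y_def)
      also have "\<dots> = - (q * y) * (1 - g * y) / (1 - q * y) * (1 - x) * (1 - d * x / q) * t k j"
        using nz q by (simp add: t_def x Suc qpoch_Suc[of q q i] qpoch_Suc[of d q i] mult_ac)
      finally show ?thesis by simp
    qed
    have factor: "u * v * (w * p) - u' * v' * w = (u * v * p - u' * v') * w" for u v w p u' v' :: real
      by (simp add: algebra_simps)
    have factor': "(u + q * y * v) * w = u * w - - q * y * v * w" for u v w :: real
      by (simp add: algebra_simps)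
    have key: "(1 - q * (x * y)) * (1 - d * (x * y)) * ((1 - g * y) / (1 - q * y))
        - (1 - g * C * (x * y)) * (1 - g * B * (x * y))
      = - y * g * (1 - B * x) * (1 - C * x)
        + q * y * ((1 - g * y) * (1 - x) * (1 - d * x / q) / (1 - q * y))"
      using y1 q by (simp add: divide_simps d_def) algebra
    have "(1 - q ^ Suc k) * (1 - d * q ^ k) * t (Suc k) j
      - (1 - g * C * q ^ k) * (1 - g * B * q ^ k) * t k j
      = ((1 - q * (x * y)) * (1 - d * (x * y)) * ((1 - g * y) / (1 - q * y))
        - (1 - g * C * (x * y)) * (1 - g * B * (x * y))) * t k j"
      unfolding t1 Q power_Suc by (rule factor)
    also have "\<dots> = G (Suc j) - G j"
      unfolding key G1 G0 by (rule factor')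
    finally show ?thesis .
  qed
  \<comment> \<open>The index \<open>Suc k\<close> occurs only in the longer sum. Its term cancels
    the boundary value \<open>G (Suc k)\<close> left by telescoping.\<close>
  have last: "(1 - q ^ Suc k) * (1 - d * q ^ k) * t (Suc k) (Suc k) = - G (Suc k)"
    using nq1[of k] nd1[of k] by (simp add: t_def G_def qpoch_Suc)
  have "(\<Sum>j\<le>k. (1 - q ^ Suc k) * (1 - d * q ^ k) * t (Suc k) j
      - (1 - g * C * q ^ k) * (1 - g * B * q ^ k) * t k j) = (\<Sum>j<Suc k. G (Suc j) - G j)"
    unfolding lessThan_Suc_atMost by (intro sum.cong) (use step in auto)
  also have "\<dots> = G (Suc k)"
    by (subst sum_lessThan_telescope) (simp add: G_def)
  finally have "(1 - q ^ Suc k) * (1 - d * q ^ k) * (\<Sum>j\<le>Suc k. t (Suc k) j)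
      = (1 - g * C * q ^ k) * (1 - g * B * q ^ k) * (\<Sum>j\<le>k. t k j)"
    using last by (simp add: sum_subtractf sum_distrib_left distrib_left del: power_Suc)
  then have "(\<Sum>j\<le>Suc k. t (Suc k) j) = (1 - g * C * q ^ k) * (1 - g * B * q ^ k)
      * (\<Sum>j\<le>k. t k j) / ((1 - q * q ^ k) * (1 - d * q ^ k))"
    using nq1[of k] nd1[of k] by (simp add: eq_divide_eq mult_ac del: sum.atMost_Suc)
  moreover have "(\<Sum>j\<le>k. t k j)
      = qpoch (g * C) q k * qpoch (g * B) q k / (qpoch q q k * qpoch d q k)"
    using Suc.IH nd[of k] by (simp add: t_def d_def)
  ultimately have "(\<Sum>j\<le>Suc k. t (Suc k) j)
      = qpoch (g * C) q (Suc k) * qpoch (g * B) q (Suc k) / (qpoch q q (Suc k) * qpoch d q (Suc k))"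
    by (simp add: qpoch_Suc mult_ac del: sum.atMost_Suc)
  then show ?case
    unfolding t_def d_def .
qed simp

text \<open>Expanding \<open>(gC;q)\<^sub>k (gB;q)\<^sub>k / (gBC;q)\<^sub>k\<close> by the Saalschuetz sum and
  exchanging the summations leaves an inner Vandermonde sum.\<close>

lemma qbinom_3phi2_transformation:
  assumes q: "q > 0" "q \<noteq> 1"
    and d: "qpoch (g * B * C) q n \<noteq> 0"
    and e: "qpoch (f * g) q n \<noteq> 0"
    and f: "qpoch f q n \<noteq> 0"
  shows "(\<Sum>k\<le>n. qbinom q n k * qsign q k * f ^ k * qpoch (g * C) q k * qpoch (g * B) q k
      / (qpoch (g * B * C) q k * qpoch (f * g) q k))
    = qpoch f q n / qpoch (f * g) q n
      * (\<Sum>k\<le>n. qbinom q n k * qsign q k * (f * g) ^ k * qpoch B q k * qpoch C q k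
          / (qpoch (g * B * C) q k * qpoch f q k))"
proof -
  define d where "d = g * B * C"
  note nq = qpoch_q_neq_0[OF q]
  have nd: "qpoch d q j \<noteq> 0" if "j \<le> n" for j
    using assms(3) that by (auto simp: d_def qpoch_eq_0_iff)
  have qb: "qbinom q n k * qpoch q q k = qpoch q q n / qpoch q q (n - k)" if "k \<le> n" for n k
    using qbinom_qpoch[OF that, of q] nq by (simp add: field_simps)
  \<comment> \<open>The summand after the Saalschuetz expansion, with k = j + i. The (q;q)_k in the
    denominator of that sum has been absorbed by the binomial coefficient.\<close>
  define h where "h = (\<lambda>j i. qpoch q q n / qpoch q q (n - (j + i)) * qsign q (j + i) * f ^ (j + i)
      / qpoch (f * g) q (j + i)
      * (qpoch B q j * qpoch C q j * qpoch g q i * g ^ j / (qpoch q q j * qpoch d q j * qpoch q q i)))"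
  have "(\<Sum>k\<le>n. qbinom q n k * qsign q k * f ^ k * qpoch (g * C) q k * qpoch (g * B) q k
      / (qpoch d q k * qpoch (f * g) q k)) = (\<Sum>k\<le>n. \<Sum>j\<le>k. h j (k - j))"
  proof (rule sum.cong[OF refl])
    fix k assume "k \<in> {..n}"
    then have k: "k \<le> n" by simp
    have "qbinom q n k * qsign q k * f ^ k * qpoch (g * C) q k * qpoch (g * B) q k
      / (qpoch d q k * qpoch (f * g) q k)
      = (qbinom q n k * qpoch q q k) * qsign q k * f ^ k / qpoch (f * g) q k *
        (qpoch (g * C) q k * qpoch (g * B) q k / (qpoch q q k * qpoch (g * B * C) q k))"
      using nq[of k] by (simp add: d_def mult_ac)
    also have "\<dots> = (\<Sum>j\<le>k. h j (k - j))"
      using nd[OF k] k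
      by (subst q_Saalschuetz[OF q, symmetric])
         (auto simp: d_def h_def qb sum_distrib_left intro!: sum.cong)
    finally show "qbinom q n k * qsign q k * f ^ k * qpoch (g * C) q k * qpoch (g * B) q k
      / (qpoch d q k * qpoch (f * g) q k) = (\<Sum>j\<le>k. h j (k - j))" .
  qed
  note expand = this
  have "(\<Sum>k\<le>n. \<Sum>j\<le>k. h j (k - j)) = (\<Sum>(j, i)\<in>{(j, i). j + i \<le> n}. h j i)"
    by (rule sum.triangle_reindex_eq[symmetric])
  also have "{(j, i). j + i \<le> n} = Sigma {..n} (\<lambda>j. {..n - j})"
    by auto
  also have "(\<Sum>(j, i)\<in>Sigma {..n} (\<lambda>j. {..n - j}). h j i) = (\<Sum>j\<le>n. \<Sum>i\<le>n - j. h j i)"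
    by (subst sum.Sigma) auto
  also have "\<dots> = (\<Sum>j\<le>n. qpoch f q n / qpoch (f * g) q n
      * (qbinom q n j * qsign q j * (f * g) ^ j * qpoch B q j * qpoch C q j
          / (qpoch d q j * qpoch f q j)))"
  proof (rule sum.cong[OF refl])
    fix j assume "j \<in> {..n}"
    then have j: "j \<le> n" by simp
    define r where "r = n - j"
    have n: "n = j + r" using j by (simp add: r_def)
    have nf: "qpoch f q j \<noteq> 0" "qpoch (f * q ^ j) q r \<noteq> 0"
      and ne: "qpoch (f * g) q j \<noteq> 0" "qpoch (f * g * q ^ j) q r \<noteq> 0"
      using e f unfolding n qpoch_add by auto
    \<comment> \<open>\<open>K\<close> collects what does not depend on \<open>i\<close>. The factor
      q^(j i) from \<open>qsign_add\<close> turns f^i into (f q^j)^i, so the inner sum is a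
      Vandermonde sum at u = f q^j.\<close>
    define K where "K = qpoch q q n / qpoch q q r * qsign q j * (f * g) ^ j * qpoch B q j * qpoch C q j
        / (qpoch q q j * qpoch d q j * qpoch (f * g) q n)"
    have "h j i = K * (qbinom q r i * (qsign q i * (f * q ^ j) ^ i * qpoch g q i
        * qpoch (g * (f * q ^ j) * q ^ i) q (r - i)))" if i: "i \<le> r" for i
    proof -
      have n2: "qpoch (f * g) q n = qpoch (f * g) q (j + i) * qpoch (f * g * q ^ (j + i)) q (r - i)"
        using i by (simp add: n flip: qpoch_add)
      then have ni: "qpoch (f * g) q (j + i) \<noteq> 0" "qpoch (f * g * q ^ (j + i)) q (r - i) \<noteq> 0"
        using e by auto
      have qbi: "qbinom q r i = qpoch q q r / (qpoch q q i * qpoch q q (r - i))"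
        using qb[OF i] nq by (simp add: field_simps)
      have c: "g * (f * q ^ j) * q ^ i = f * g * q ^ (j + i)"
        by (simp add: power_add)
      show ?thesis
        unfolding K_def c qbi n2 h_def qsign_add
        using ni nq[of r] nq[of i] nq[of j] i
        by (simp add: n power_add power_mult_distrib mult_ac flip: power_mult)
    qed
    then have "(\<Sum>i\<le>n - j. h j i) = K * qpoch (f * q ^ j) q r"
      by (simp add: r_def[symmetric] q_Vandermonde flip: sum_distrib_left)
    also have "\<dots> = qpoch f q n / qpoch (f * g) q n
      * (qbinom q n j * qsign q j * (f * g) ^ j * qpoch B q j * qpoch C q j
          / (qpoch d q j * qpoch f q j))"
    proof -
      have "qbinom q n j = qpoch q q n / (qpoch q q j * qpoch q q r)"
        using qb[OF j] nq by (simp add: r_def field_simps)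
      moreover have "qpoch f q n = qpoch f q j * qpoch (f * q ^ j) q r"
        by (simp add: n qpoch_add)
      ultimately show ?thesis
        using nf by (simp add: K_def mult_ac)
    qed
    finally show "(\<Sum>i\<le>n - j. h j i) = qpoch f q n / qpoch (f * g) q n
      * (qbinom q n j * qsign q j * (f * g) ^ j * qpoch B q j * qpoch C q j
          / (qpoch d q j * qpoch f q j))" .
  qed
  finally show ?thesis
    using expand by (simp add: d_def sum_distrib_left)
qed

section \<open>Reversal of products, inversion of the base, and the transformation with adapted
  ranges\<close>

text \<open>Read backwards, the factors are 1 - u/q^i = u (-1/q^i) (1 - q^i/u) for i = 1, ..., n.
  The product of the -1/q^i is the case u = 1, that is (q^(-n);q)_n / (q;q)_n, so no explicit sign
  or quadratic exponent appears.\<close>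

lemma qpoch_reverse:
  assumes "q > 0" "u \<noteq> 0"
  shows "qpoch (u / q ^ n) q n * qpoch q q n = u ^ n * qpoch (q / u) q n * qpoch (1 / q ^ n) q n"
proof (induction n)
  case (Suc n)
  have shift: "qpoch (v / q ^ Suc n) q (Suc n) = (1 - v / q ^ Suc n) * qpoch (v / q ^ n) q n" for v
    using assms by (simp add: qpoch_Suc_left)
  have factor: "(1 - u / q ^ Suc n) * (1 - q * q ^ n) = u * (1 - q / u * q ^ n) * (1 - 1 / q ^ Suc n)"
    using assms by (simp add: field_simps)
  have "qpoch (u / q ^ Suc n) q (Suc n) * qpoch q q (Suc n)
      = ((1 - u / q ^ Suc n) * (1 - q * q ^ n)) * (qpoch (u / q ^ n) q n * qpoch q q n)"
    by (simp only: shift qpoch_Suc[of q q] mult_ac)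
  also have "\<dots> = u ^ Suc n * qpoch (q / u) q (Suc n) * qpoch (1 / q ^ Suc n) q (Suc n)"
    unfolding factor Suc.IH by (simp only: shift qpoch_Suc[of "q / u"] power_Suc[of u] mult_ac)
  finally show ?case .
qed simp

text \<open>Factorwise 1 - 1/(u q^i) = (1 - u q^i) / (-u q^i). This brings the base q^(-1) of
  \<open>qHahn_V\<close> back to base \<open>q\<close>.\<close>

lemma qpoch_inverse_base:
  assumes "q > 0" "u \<noteq> 0"
  shows "qpoch (1 / u) (1 / q) k = qpoch u q k / (u ^ k * qsign q k)"
proof (induction k)
  case (Suc k)
  have "1 - 1 / u * (1 / q) ^ k = (1 - u * q ^ k) / (u * - (q ^ k))"
    using assms by (simp add: field_simps)
  then show ?case
    using Suc by (simp add: qpoch_Suc qsign_Suc mult_ac)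
qed simp

text \<open>The transformation for the terminating parameter q^(-r), with g = 1/B, upper parameters
  q^(-m) and B/q^M on the right, and f = z/q^r. The ranges are those of the scalar product and of
  \<open>qHahn_V\<close>; terms beyond \<open>r\<close>, or on the right beyond \<open>m\<close>,
  vanish.\<close>

lemma three_phi_two_transformation:
  assumes q: "q > 0" "q \<noteq> 1" and B: "B \<noteq> 0"
    and r: "r \<le> M + m"
    and e: "qpoch (z / (B * q ^ r)) q r \<noteq> 0"
    and f: "qpoch (z / q ^ r) q r \<noteq> 0"
  shows "(\<Sum>j\<le>M + m. qpoch (1 / q ^ M) q j * qpoch (1 / (q ^ m * B)) q j * qpoch (1 / q ^ r) q j
        / (qpoch q q j * qpoch (1 / q ^ (M + m)) q j * qpoch (z / (B * q ^ r)) q j) * z ^ j)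
    = qpoch (z / q ^ r) q r / qpoch (z / (B * q ^ r)) q r
      * (\<Sum>k\<le>m. qpoch (1 / q ^ m) q k * qpoch (1 / q ^ r) q k * qpoch (B / q ^ M) q k
          / (qpoch q q k * qpoch (1 / q ^ (M + m)) q k * qpoch (z / q ^ r) q k) * (z / B) ^ k)"
    (is "sum ?L _ = _ * sum ?R _")
proof -
  note vanish = qpoch_inverse_power_eq_0[OF q(1)]
  have g: "1 / (q ^ m * B) * (B / q ^ M) = 1 / q ^ (M + m)" "z / q ^ r * (1 / B) = z / (B * q ^ r)"
    "1 / B * (B / q ^ M) = 1 / q ^ M" "1 / B * (1 / q ^ m) = 1 / (q ^ m * B)"
    using B by (simp_all add: power_add mult_ac)
  have d: "qpoch (1 / q ^ (M + m)) q r \<noteq> 0"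
    using qpoch_inverse_power_neq_0[OF q r] .
  have pw: "qbinom q r k * qsign q k * (v / q ^ r) ^ k = qpoch (1 / q ^ r) q k / qpoch q q k * v ^ k"
    if "k \<le> r" for k v
    unfolding qbinom_qsign[OF q that] using q by (simp add: power_divide power_mult)
  have "sum ?L {..M + m} = sum ?L {..r}"
    using r by (intro sum.mono_neutral_right) (auto simp: vanish)
  also have "\<dots> = (\<Sum>k\<le>r. qbinom q r k * qsign q k * (z / q ^ r) ^ k
      * qpoch (1 / q ^ M) q k * qpoch (1 / (q ^ m * B)) q k
      / (qpoch (1 / q ^ (M + m)) q k * qpoch (z / (B * q ^ r)) q k))"
    using pw[of _ z] by (intro sum.cong) (simp_all add: mult_ac)
  also have "\<dots> = qpoch (z / q ^ r) q r / qpoch (z / (B * q ^ r)) q r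
      * (\<Sum>k\<le>r. qbinom q r k * qsign q k * (z / (B * q ^ r)) ^ k * qpoch (1 / q ^ m) q k
          * qpoch (B / q ^ M) q k / (qpoch (1 / q ^ (M + m)) q k * qpoch (z / q ^ r) q k))"
    using qbinom_3phi2_transformation[OF q, of "1 / B" "1 / q ^ m" "B / q ^ M" r "z / q ^ r",
        unfolded g, OF d e f] .
  also have "(\<Sum>k\<le>r. qbinom q r k * qsign q k * (z / (B * q ^ r)) ^ k * qpoch (1 / q ^ m) q k
          * qpoch (B / q ^ M) q k / (qpoch (1 / q ^ (M + m)) q k * qpoch (z / q ^ r) q k)) = sum ?R {..r}"
    using pw[of _ "z / B"] by (intro sum.cong) (simp_all add: mult_ac)
  \<comment> \<open>Either of \<open>r\<close> and \<open>m\<close> may be larger, so the range is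
    first extended to the maximum and then cut down.\<close>
  also have "sum ?R {..r} = sum ?R {..max r m}"
    by (intro sum.mono_neutral_left) (auto simp: vanish)
  also have "\<dots> = sum ?R {..m}"
    by (intro sum.mono_neutral_right) (auto simp: vanish)
  finally show ?thesis .
qed

section \<open>Real exponents, coordinates in the basis, and integer indices\<close>

lemma powr_mult_nat:
  fixes q :: real
  assumes "q > 0"
  shows "q powr (u * real k) = (q powr u) ^ k"
  using assms by (simp add: powr_realpow flip: powr_powr)

lemma inner_orthonormal_sum:
  fixes ket :: "nat \<Rightarrow> 'v::real_inner"
  assumes "\<And>i j. i \<le> N \<Longrightarrow> j \<le> N \<Longrightarrow> ket i \<bullet> ket j = (if i = j then 1 else 0)"
  shows "(\<Sum>l\<le>N. c l *\<^sub>R ket l) \<bullet> (\<Sum>l\<le>N. d l *\<^sub>R ket l) = (\<Sum>l\<le>N. c l * d l)"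
proof -
  have "(\<Sum>l\<le>N. c l *\<^sub>R ket l) \<bullet> (\<Sum>l\<le>N. d l *\<^sub>R ket l)
      = (\<Sum>l\<le>N. \<Sum>l'\<le>N. c l * d l' * (ket l \<bullet> ket l'))"
    unfolding inner_sum_left unfolding inner_sum_right by (simp add: mult_ac)
  also have "\<dots> = (\<Sum>l\<le>N. \<Sum>l'\<le>N. if l' = l then c l * d l' else 0)"
    by (intro sum.cong) (auto simp: assms)
  finally show ?thesis by simp
qed

lemma shift_operator_sum:
  fixes ket :: "nat \<Rightarrow> 'v::real_vector"
  assumes Z: "linear Z" "\<And>n. n < N \<Longrightarrow> Z (ket n) = - ket n + A n *\<^sub>R ket (n + 1)"
      "Z (ket N) = - ket N"
  shows "Z (\<Sum>l\<le>N. d l *\<^sub>R ket l)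
    = (\<Sum>l\<le>N. (- d l + (if l = 0 then 0 else A (l - 1) * d (l - 1))) *\<^sub>R ket l)"
proof -
  have "Z (\<Sum>l\<le>N. d l *\<^sub>R ket l) = (\<Sum>l\<le>N. d l *\<^sub>R Z (ket l))"
    using Z(1) by (simp add: linear_sum linear_scale)
  also have "\<dots> = (\<Sum>l\<le>N. - d l *\<^sub>R ket l + (if l < N then (d l * A l) *\<^sub>R ket (Suc l) else 0))"
    by (rule sum.cong) (auto simp: Z order.strict_iff_order scaleR_right_diff_distrib)
  also have "\<dots> = (\<Sum>l\<le>N. - d l *\<^sub>R ket l) + (\<Sum>l\<le>N. if l < N then (d l * A l) *\<^sub>R ket (Suc l) else 0)"
    by (rule sum.distrib)
  also have "(\<Sum>l\<le>N. if l < N then (d l * A l) *\<^sub>R ket (Suc l) else 0)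
      = (\<Sum>l<N. (d l * A l) *\<^sub>R ket (Suc l))"
    by (intro sum.mono_neutral_cong_right) auto
  also have "(\<Sum>l<N. (d l * A l) *\<^sub>R ket (Suc l))
      = (\<Sum>l\<le>N. (if l = 0 then 0 else A (l - 1) * d (l - 1)) *\<^sub>R ket l)"
    by (simp add: sum.atMost_shift mult.commute)
  finally show ?thesis
    by (simp only: scaleR_add_left sum.distrib)
qed

text \<open>The addition formula for the index m + (M - m), extended to negative M - m. In that case
  the symbol is a reciprocal, and the hypothesis makes its denominator nonzero.\<close>

lemma qpoch_int_split:
  assumes q: "q > 0" and nz: "qpoch_int v q (int M - int m) \<noteq> 0"
  shows "qpoch (v / q ^ m) q M = qpoch (v / q ^ m) q m * qpoch_int v q (int M - int m)"
proof (cases "m \<le> M")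
  case True
  then have "qpoch (v / q ^ m) q (m + (M - m)) = qpoch (v / q ^ m) q m * qpoch v q (M - m)"
    using q by (simp only: qpoch_add) simp
  then show ?thesis
    using True by (simp add: qpoch_int_def nat_diff_distrib)
next
  case False
  have "v * q powi (int M - int m) = v / q ^ m * q ^ M"
    using q by (simp add: power_int_diff)
  then have i: "qpoch_int v q (int M - int m) = 1 / qpoch (v / q ^ m * q ^ M) q (m - M)"
    using False by (simp add: qpoch_int_def nat_diff_distrib)
  have "qpoch (v / q ^ m) q (M + (m - M)) = qpoch (v / q ^ m) q M * qpoch (v / q ^ m * q ^ M) q (m - M)"
    by (simp only: qpoch_add)
  then show ?thesis
    using False nz by (simp add: i)
qed

section \<open>The scalar products of e_m and d_n*\<close>

lemma vec_e_inner_vec_d_star: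
  fixes ket :: "nat \<Rightarrow> 'v::real_inner"
  assumes q: "q > 0" "q \<noteq> 1"
    and A: "\<And>i. i < N \<Longrightarrow> A i \<noteq> 0"
    and orthonormal: "\<And>i j. i \<le> N \<Longrightarrow> j \<le> N \<Longrightarrow> ket i \<bullet> ket j = (if i = j then 1 else 0)"
    and a: "a = \<alpha> - \<beta>"
    and b: "b = real N - 2 * \<beta> - 1"
    and mn: "m \<le> N" "n \<le> N"
    and y: "qpoch (q powr (- real m - b)) q m \<noteq> 0"
  shows "vec_e q \<alpha> \<beta> N A ket m \<bullet> vec_d_star q \<alpha> \<beta> N A ket n =
      ((\<Prod>i<n. A i) / (\<Prod>i<m. A i))
      * q powr ((a + real m - real N - 1) * real m)
      * ((qpoch (q powr (1 - a)) q n * qpoch (q powr (1 + b)) q m)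
         / (qpoch q q n * qpoch (q powr (real m + b - real N)) q m))
      * qHahn_U m (real n) a b N q"
proof -
  have inner: "(\<Sum>l\<le>N. c l *\<^sub>R ket l) \<bullet> (\<Sum>l\<le>N. d l *\<^sub>R ket l) = (\<Sum>l\<le>N. c l * d l)" for c d
    by (rule inner_orthonormal_sum) (rule orthonormal)
  \<comment> \<open>Real powers of \<open>q\<close> become monomials in t = q^a, B = q^b and integer
    powers of \<open>q\<close>, on which the simplifier can compute.\<close>
  define t where "t = q powr a"
  define B where "B = q powr b"
  define g where "g = q powr (real m + b - real N)"
  define h where "h = t / q ^ n"
  have tB: "t \<noteq> 0" "B \<noteq> 0" using q by (simp_all add: t_def B_def)
  note powr = powr_mult_nat[OF q(1)] powr_add powr_diff powr_minus powr_realpow[OF q(1)]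
  have conv:
    "q powr (- real k) = 1 / q ^ k"
    "q powr ((\<alpha> - \<beta> - 1) * real k) = (t / q) ^ k"
    "q powr ((\<beta> - \<alpha>) * real k) = (1 / t) ^ k"
    "q powr (real m - 2 * \<beta> - 1) = g"
    "q powr (- real n + \<alpha> - \<beta>) = h"
    "q powr (a - real n) = h"
    "q powr (1 - a) = q / t"
    "q powr (1 + b) = q * B"
    "q powr (- real m - b) = (1 / B) / q ^ m" for k
  proof -
    show "q powr (- real k) = 1 / q ^ k"
      by (simp add: powr inverse_eq_divide)
    show "q powr ((\<alpha> - \<beta> - 1) * real k) = (t / q) ^ k"
      using q by (simp add: powr t_def a)
    show "q powr ((\<beta> - \<alpha>) * real k) = (1 / t) ^ k"
      by (simp add: powr t_def a)
    show "q powr (real m - 2 * \<beta> - 1) = g"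
    proof -
      have "real m + b - real N = real m - 2 * \<beta> - 1" by (simp add: b)
      then show ?thesis by (simp only: g_def)
    qed
    show "q powr (- real n + \<alpha> - \<beta>) = h"
      by (simp add: powr t_def h_def a inverse_eq_divide mult.commute)
    show "q powr (a - real n) = h"
      by (simp add: powr t_def h_def)
    show "q powr (1 - a) = q / t"
      using q by (simp add: powr t_def)
    show "q powr (1 + b) = q * B"
      using q by (simp add: powr B_def)
    show "q powr (- real m - b) = (1 / B) / q ^ m"
      by (simp add: powr B_def inverse_eq_divide)
  qed
  have c1: "q powr ((a + real m - real N - 1) * real m) = (t * q ^ m / (q ^ N * q)) ^ m"
    using q by (simp add: powr t_def)
  have c2: "q powr (real m * (real N - real m - b)) = (q ^ N / (q ^ m * B)) ^ m"
    using q by (subst mult.commute) (simp add: powr B_def)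
  define S where "S = (\<Sum>k\<le>m. (qpoch (1 / q ^ m) q k * qpoch (1 / q ^ n) q k * qpoch g q k)
      / (qpoch (1 / q ^ N) q k * qpoch h q k) * (q ^ k / qpoch q q k))"
  have U: "qHahn_U m (real n) a b N q
      = (q ^ N / (q ^ m * B)) ^ m * (qpoch (1 / q ^ N) q m / qpoch ((1 / B) / q ^ m) q m) * S"
    unfolding qHahn_U_def S_def c2 conv
    by (simp add: g_def add.commute)
  define K where "K = (\<Prod>i<n. A i) / (\<Prod>i<m. A i) * ((t / q) ^ m * (1 / t) ^ n)
      / (qpoch (1 / q ^ m) q m * qpoch (1 / q ^ n) q n)
      * qpoch q q m * qpoch (1 / q ^ N) q m / qpoch g q m * qpoch h q n"
  have "vec_e q \<alpha> \<beta> N A ket m \<bullet> vec_d_star q \<alpha> \<beta> N A ket n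
      = (\<Sum>l\<le>N. K * ((qpoch (1 / q ^ m) q l * qpoch (1 / q ^ n) q l * qpoch g q l)
      / (qpoch (1 / q ^ N) q l * qpoch h q l) * (q ^ l / qpoch q q l)))"
    unfolding vec_e_def vec_d_star_def conv inner
  proof (rule sum.cong[OF refl])
    fix l assume "l \<in> {..N}"
    then have l: "(\<Prod>i<l. A i) \<noteq> 0" using A by auto
    \<comment> \<open>The powers depending on \<open>l\<close> in the two vectors multiply to
      exactly the q^l of the series; the products of the constants cancel.\<close>
    have "(1 / t) ^ l * (t / q) ^ l * q ^ l = 1"
      using tB q by (simp flip: power_mult_distrib)
    then have ql: "q ^ l = 1 / ((t / q) ^ l * (1 / t) ^ l)"
      using tB q by (simp add: field_simps)
    show "(\<Prod>i<l. A i) / (\<Prod>i<m. A i) * ((t / q) ^ m / (t / q) ^ l) *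
      (qpoch (1 / q ^ m) q l / qpoch (1 / q ^ m) q m) * (qpoch q q m / qpoch q q l) *
      (qpoch (1 / q ^ N) q m / qpoch (1 / q ^ N) q l) * (qpoch g q l / qpoch g q m) *
      ((\<Prod>i<n. A i) / (\<Prod>i<l. A i) * ((1 / t) ^ n / (1 / t) ^ l) *
      (qpoch (1 / q ^ n) q l / qpoch (1 / q ^ n) q n) * (qpoch h q n / qpoch h q l))
      = K * ((qpoch (1 / q ^ m) q l * qpoch (1 / q ^ n) q l * qpoch g q l)
      / (qpoch (1 / q ^ N) q l * qpoch h q l) * (q ^ l / qpoch q q l))"
      unfolding ql K_def using l by (simp add: mult_ac del: power_one_over)
  qed
  also have "\<dots> = K * S"
    unfolding S_def sum_distrib_left using mn
    by (intro sum.mono_neutral_right) (auto simp: qpoch_inverse_power_eq_0[OF q(1)])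
  \<comment> \<open>The prefactors agree after two product reversals: at u = t for the factor from
    d_n*, and at u = 1/B for the denominator of \<open>qHahn_U\<close>.\<close>
  also have "K = ((\<Prod>i<n. A i) / (\<Prod>i<m. A i))
      * (t * q ^ m / (q ^ N * q)) ^ m
      * ((qpoch (q / t) q n * qpoch (q * B) q m) / (qpoch q q n * qpoch g q m))
      * ((q ^ N / (q ^ m * B)) ^ m * (qpoch (1 / q ^ N) q m / qpoch ((1 / B) / q ^ m) q m))"
  proof -
    have h: "qpoch h q n = t ^ n * qpoch (q / t) q n * qpoch (1 / q ^ n) q n / qpoch q q n"
      using qpoch_reverse[OF q(1) tB(1), of n] qpoch_q_neq_0[OF q, of n]
      by (simp add: h_def field_simps)
    have y': "qpoch ((1 / B) / q ^ m) q m \<noteq> 0" using y conv by simp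
    have "qpoch ((1 / B) / q ^ m) q m * qpoch q q m = (1 / B) ^ m * qpoch (q * B) q m * qpoch (1 / q ^ m) q m"
      using qpoch_reverse[OF q(1), of "1 / B" m] tB by simp
    then have m: "qpoch q q m / qpoch (1 / q ^ m) q m
        = (1 / B) ^ m * qpoch (q * B) q m / qpoch ((1 / B) / q ^ m) q m"
      using y' qpoch_inverse_power_neq_0[OF q, of m m] by (subst frac_eq_eq) (simp_all add: mult_ac)
    have "(t * q ^ m / (q ^ N * q)) * (q ^ N / (q ^ m * B)) = (t / q) * (1 / B)"
      using q by (simp add: field_simps)
    then have p: "(t * q ^ m / (q ^ N * q)) ^ m * (q ^ N / (q ^ m * B)) ^ m = (t / q) ^ m * (1 / B) ^ m"
      by (simp only: flip: power_mult_distrib)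
    have nn: "qpoch (1 / q ^ n) q n \<noteq> 0"
      using qpoch_inverse_power_neq_0[OF q, of n n] by simp
    have "K = (\<Prod>i<n. A i) / (\<Prod>i<m. A i) * (t / q) ^ m
      * (qpoch q q m / qpoch (1 / q ^ m) q m) * qpoch (1 / q ^ N) q m / qpoch g q m
      * qpoch (q / t) q n / qpoch q q n"
      unfolding K_def h using nn tB by (simp add: power_divide mult_ac)
    also have "\<dots> = (\<Prod>i<n. A i) / (\<Prod>i<m. A i) * ((t / q) ^ m * (1 / B) ^ m)
      * qpoch (q * B) q m / qpoch ((1 / B) / q ^ m) q m * qpoch (1 / q ^ N) q m / qpoch g q m
      * qpoch (q / t) q n / qpoch q q n"
      unfolding m by (simp add: mult_ac)
    finally show ?thesis
      unfolding p[symmetric] by (simp add: mult_ac)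
  qed
  finally show ?thesis
    unfolding U c1 conv g_def[symmetric] by (simp only: mult.assoc)
qed

section \<open>The scalar products of e_m* and Z d_n\<close>

text \<open>Every symbol in base q^(-1) is converted to base \<open>q\<close>. Three
  \<open>qsign\<close> factors above and three below cancel, and the remaining monomials combine
  into the argument q^2/q^a.\<close>

lemma qHahn_V_eq:
  assumes q: "q > 0" "q \<noteq> 1" and N: "N = M + m" "N = n + r"
  shows "qHahn_V m (real n) a b N q
    = qpoch (1 / q ^ N) q m / qpoch (1 / (q ^ m * q powr b)) q m
      * (\<Sum>k\<le>m. qpoch (1 / q ^ m) q k * qpoch (1 / q ^ r) q k * qpoch (q powr b / q ^ M) q k
          / (qpoch q q k * qpoch (1 / q ^ N) q k * qpoch (q powr b * q\<^sup>2 / q powr a / q ^ r) q k)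
          * (q\<^sup>2 / q powr a) ^ k)"
proof -
  define t where "t = q powr a"
  define B where "B = q powr b"
  have tB: "t \<noteq> 0" "B \<noteq> 0" "q \<noteq> 0" using q by (simp_all add: t_def B_def)
  note powr = powr_mult_nat[OF q(1)] powr_add powr_diff powr_minus powr_realpow[OF q(1)]
  have inv: "inverse q powr u = 1 / q powr u" for u
    using q by (simp add: powr_divide inverse_eq_divide)
  note base = qpoch_inverse_base[OF q(1)]
  have p: "qpoch (inverse q powr (- real k)) (inverse q) j
      = qpoch (1 / q ^ k) q j / ((1 / q ^ k) ^ j * qsign q j)" for k j
    using base[of "1 / q ^ k" j] q unfolding inv by (simp add: powr inverse_eq_divide)
  have pq: "qpoch (inverse q) (inverse q) j = qpoch q q j / (q ^ j * qsign q j)" for j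
    using base[of q j] q by (simp add: inverse_eq_divide)
  have py: "qpoch (inverse q powr (- real m - b)) (inverse q) m
      = qpoch (1 / (q ^ m * B)) q m / ((1 / (q ^ m * B)) ^ m * qsign q m)"
    using base[of "1 / (q ^ m * B)" m] tB unfolding inv by (simp add: powr inverse_eq_divide B_def)
  have pg: "qpoch (inverse q powr (b + real m - real N)) (inverse q) j
      = qpoch (B / q ^ M) q j / ((B / q ^ M) ^ j * qsign q j)" for j
    using base[of "B / q ^ M" j] tB unfolding inv by (simp add: N powr inverse_eq_divide B_def power_add)
  have pr: "- (real N - real n) = - real r"
    by (simp add: N(2))
  have e: "q powr ((b - a + 2) - (real N - real n)) = B * q\<^sup>2 / t / q ^ r"
    using q by (simp add: N(2) powr B_def t_def powr_numeral)
  have pf: "qpoch (inverse q powr ((b - a + 2) - (real N - real n))) (inverse q) j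
      = qpoch (B * q\<^sup>2 / t / q ^ r) q j / ((B * q\<^sup>2 / t / q ^ r) ^ j * qsign q j)" for j
    using base[of "B * q\<^sup>2 / t / q ^ r" j] tB unfolding inv e by (simp add: inverse_eq_divide)
  have pp: "inverse q powr (real m * (real N - real m - b)) = (B / q ^ M) ^ m"
    using q unfolding inv by (subst mult.commute) (simp add: N powr B_def power_divide)
  have pre: "(B / q ^ M) ^ m * (qpoch (1 / q ^ N) q m / ((1 / q ^ N) ^ m * qsign q m)
        / (qpoch (1 / (q ^ m * B)) q m / ((1 / (q ^ m * B)) ^ m * qsign q m)))
      = qpoch (1 / q ^ N) q m / qpoch (1 / (q ^ m * B)) q m"
  proof -
    have "(B / q ^ M) * (1 / (q ^ m * B)) = 1 / q ^ N"
      using tB by (simp add: N power_add)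
    then have *: "(1 / q ^ N) ^ m = (B / q ^ M) ^ m * (1 / (q ^ m * B)) ^ m"
      by (simp only: flip: power_mult_distrib)
    have "x * (w / (x * y * s) / (v / (y * s))) = w / v" if "x \<noteq> 0" "y \<noteq> 0" "s \<noteq> 0" for x y s v w :: real
      using that by simp
    then show ?thesis
      unfolding * using tB qsign_neq_0[OF tB(3)] by simp
  qed
  have "qHahn_V m (real n) a b N q = qpoch (1 / q ^ N) q m / qpoch (1 / (q ^ m * B)) q m
     * (\<Sum>k\<le>m. (qpoch (1 / q ^ m) q k / ((1 / q ^ m) ^ k * qsign q k)
        * (qpoch (1 / q ^ r) q k / ((1 / q ^ r) ^ k * qsign q k))
        * (qpoch (B / q ^ M) q k / ((B / q ^ M) ^ k * qsign q k)))
        / (qpoch (1 / q ^ N) q k / ((1 / q ^ N) ^ k * qsign q k)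
        * (qpoch (B * q\<^sup>2 / t / q ^ r) q k / ((B * q\<^sup>2 / t / q ^ r) ^ k * qsign q k)))
        * (inverse q ^ k / (qpoch q q k / (q ^ k * qsign q k))))"
    unfolding qHahn_V_def qHahn_U_def pr p pq py pg pf pp pre ..
  also have "\<dots> = qpoch (1 / q ^ N) q m / qpoch (1 / (q ^ m * B)) q m
     * (\<Sum>k\<le>m. qpoch (1 / q ^ m) q k * qpoch (1 / q ^ r) q k * qpoch (B / q ^ M) q k
          / (qpoch q q k * qpoch (1 / q ^ N) q k * qpoch (B * q\<^sup>2 / t / q ^ r) q k)
          * (q\<^sup>2 / t) ^ k)"
  proof (rule arg_cong2[where f = "(*)", OF refl], rule sum.cong[OF refl])
    fix k assume "k \<in> {..m}"
    have "(q\<^sup>2 / t) * ((1 / q ^ m) * (1 / q ^ r) * (B / q ^ M)) = (1 / q ^ N) * (B * q\<^sup>2 / t / q ^ r) * (inverse q * q)"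
      using tB by (simp add: N(1) power_add mult_ac)
    then have *: "(q\<^sup>2 / t) ^ k * ((1 / q ^ m) ^ k * (1 / q ^ r) ^ k * (B / q ^ M) ^ k)
       = (1 / q ^ N) ^ k * (B * q\<^sup>2 / t / q ^ r) ^ k * (inverse q ^ k * q ^ k)"
      by (simp only: flip: power_mult_distrib)
    \<comment> \<open>The cancellation is stated for abstract variables, so that the only fact
      needed about the powers is the balance just proved.\<close>
    have "(u1 / (x1 * s) * (u2 / (x2 * s)) * (u3 / (x3 * s))) / (v1 / (y1 * s) * (v2 / (y2 * s))) * (z / (v3 / (y3 * s)))
      = u1 * u2 * u3 / (v3 * v1 * v2) * w"
      if "w * (x1 * x2 * x3) = y1 * y2 * (z * y3)" "x1 \<noteq> 0" "x2 \<noteq> 0" "x3 \<noteq> 0" "s \<noteq> 0"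
      for u1 u2 u3 v1 v2 v3 x1 x2 x3 y1 y2 y3 s w z :: real
    proof -
      have w: "w = y1 * y2 * (z * y3) / (x1 * x2 * x3)"
        using that by (simp add: eq_divide_eq)
      show ?thesis unfolding w using that by (simp add: mult_ac)
    qed
    from this[OF *]
    show "qpoch (1 / q ^ m) q k / ((1 / q ^ m) ^ k * qsign q k)
        * (qpoch (1 / q ^ r) q k / ((1 / q ^ r) ^ k * qsign q k))
        * (qpoch (B / q ^ M) q k / ((B / q ^ M) ^ k * qsign q k))
        / (qpoch (1 / q ^ N) q k / ((1 / q ^ N) ^ k * qsign q k)
        * (qpoch (B * q\<^sup>2 / t / q ^ r) q k / ((B * q\<^sup>2 / t / q ^ r) ^ k * qsign q k)))
        * (inverse q ^ k / (qpoch q q k / (q ^ k * qsign q k)))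
      = qpoch (1 / q ^ m) q k * qpoch (1 / q ^ r) q k * qpoch (B / q ^ M) q k
          / (qpoch q q k * qpoch (1 / q ^ N) q k * qpoch (B * q\<^sup>2 / t / q ^ r) q k)
          * (q\<^sup>2 / t) ^ k"
      using tB qsign_neq_0[OF tB(3)] by simp
  qed
  finally show ?thesis
    unfolding B_def t_def .
qed

text \<open>Over a common denominator the numerators differ by (1 - q^(j-r)) - (1 - c q^j) = (c -
  q^(-r)) q^j, and (c;q)_(j+1) = (1 - c) (cq;q)_j. For \<open>j > r\<close> everything vanishes, so
  the condition on \<open>c\<close> is restricted to \<open>j \<le> r\<close>.\<close>

lemma qpoch_ratio_shift:
  assumes q: "q > 0"
    and c: "j \<le> r \<Longrightarrow> qpoch c q (Suc j) \<noteq> 0"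
  shows "qpoch (1 / q ^ r) q (Suc j) / qpoch c q (Suc j) - qpoch (1 / q ^ r) q j / qpoch c q j
    = (c - 1 / q ^ r) * q ^ j * qpoch (1 / q ^ r) q j / ((1 - c) * qpoch (c * q) q j)"
proof (cases "j \<le> r")
  case True
  have "qpoch c q j \<noteq> 0" "1 - c * q ^ j \<noteq> 0"
    using c[OF True] by (auto simp: qpoch_Suc)
  then have "qpoch (1 / q ^ r) q (Suc j) / qpoch c q (Suc j) - qpoch (1 / q ^ r) q j / qpoch c q j
    = (c - 1 / q ^ r) * q ^ j * qpoch (1 / q ^ r) q j / qpoch c q (Suc j)"
    unfolding qpoch_Suc by (simp add: field_simps)
  then show ?thesis by (simp add: qpoch_Suc_left)
next
  case False
  then show ?thesis
    using qpoch_inverse_power_eq_0[OF q, of r] by simp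
qed


lemma vec_e_star_inner_Z_vec_d:
  fixes ket :: "nat \<Rightarrow> 'v::real_inner"
  assumes q: "q > 0" "q \<noteq> 1"
    and A: "\<And>i. i < N \<Longrightarrow> A i \<noteq> 0"
    and orthonormal: "\<And>i j. i \<le> N \<Longrightarrow> j \<le> N \<Longrightarrow> ket i \<bullet> ket j = (if i = j then 1 else 0)"
    and Z: "linear Z"
      "\<And>n. n < N \<Longrightarrow> Z (ket n) = - ket n + A n *\<^sub>R ket (n + 1)"
      "Z (ket N) = - ket N"
    and a: "a = \<alpha> - \<beta>"
    and b: "b = real N - 2 * \<beta> - 1"
    and N: "N = M + m" "N = n + r"
    and nz: "\<And>j. j \<le> r \<Longrightarrow> qpoch (q / q powr a / q ^ r) q (Suc j) \<noteq> 0"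
      "qpoch (q powr b * q\<^sup>2 / q powr a / q ^ r) q r \<noteq> 0"
      "qpoch (q\<^sup>2 / q powr a / q ^ r) q r \<noteq> 0"
      "qpoch_int (q powr (- b)) q (int N - 2 * int m) \<noteq> 0"
  shows "vec_e_star q \<alpha> \<beta> N A ket m \<bullet> Z (vec_d q \<alpha> \<beta> N A ket n) =
      - ((\<Prod>i\<in>{n..<N}. A i) / (\<Prod>i\<in>{m..<N}. A i))
      * q powr ((a - b - real m - 1) * (real N - real m) + (b - a + 1) * (real N - real n))
      * ((qpoch (q powr (real m + 1)) q (N - m) * qpoch (q powr (a - b - 1)) q (N - n))
         / (qpoch q q (N - n) * qpoch (q powr (- real N)) q m
            * qpoch_int (q powr (- b)) q (int N - 2 * int m)))
      * qHahn_V m (real n) a b N q"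
proof -
  have inner: "(\<Sum>l\<le>N. c l *\<^sub>R ket l) \<bullet> (\<Sum>l\<le>N. d l *\<^sub>R ket l) = (\<Sum>l\<le>N. c l * d l)" for c d
    by (rule inner_orthonormal_sum) (rule orthonormal)
  have shift: "Z (\<Sum>l\<le>N. d l *\<^sub>R ket l)
    = (\<Sum>l\<le>N. (- d l + (if l = 0 then 0 else A (l - 1) * d (l - 1))) *\<^sub>R ket l)" for d
    by (rule shift_operator_sum) (use Z in auto)
  define t where "t = q powr a"
  define B where "B = q powr b"
  define z0 where "z0 = t / (B * q)"
  define y where "y = 1 / (q ^ m * B)"
  define x where "x = 1 / q ^ r"
  define c where "c = q / t / q ^ r"
  define e where "e = q\<^sup>2 / t / q ^ r"
  define f where "f = B * q\<^sup>2 / t / q ^ r"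
  define P where "P k = (\<Prod>i\<in>{k..<N}. A i)" for k
  have tB: "t \<noteq> 0" "B \<noteq> 0" "q \<noteq> 0" "z0 \<noteq> 0" using q by (simp_all add: t_def B_def z0_def)
  note nq = qpoch_q_neq_0[OF q]
  note powr = powr_mult_nat[OF q(1)] powr_add powr_diff powr_minus powr_realpow[OF q(1)]
  have Nm: "N - m = M" "N - n = r" "real N - real m = real M" "real N - real n = real r"
    "int N - 2 * int m = int M - int m"
    using N by simp_all
  have conv1: "q powr ((\<alpha> + \<beta> - real N) * real k) = z0 ^ k" for k
  proof -
    have "\<alpha> + \<beta> - real N = a - b - 1" by (simp add: a b)
    then show ?thesis using q by (simp only: powr_mult_nat) (simp add: powr z0_def t_def B_def)
  qed
  have conv2: "q powr (- real N - real m + 2 * \<beta> + 1) = y"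
  proof -
    have "- real N - real m + 2 * \<beta> + 1 = - b - real m" by (simp add: b)
    then show ?thesis by (simp only:) (simp add: powr y_def B_def inverse_eq_divide)
  qed
  have conv3: "q powr (real n - real N - \<alpha> + \<beta> + 1) = c"
  proof -
    have "real n - real N - \<alpha> + \<beta> + 1 = 1 - a - real r" by (simp add: a N(2))
    then show ?thesis using q by (simp only:) (simp add: powr c_def t_def)
  qed
  have conv4: "q powr (real n - real N) = x" "q powr (real m - real N) = 1 / q ^ M"
    "q powr (- real N) = 1 / q ^ N"
    using tB by (simp_all add: N(2) x_def powr inverse_eq_divide)
       (simp_all add: N(1)[unfolded N(2)] powr field_simps flip: power_add of_nat_add)
  have conv5: "q powr (real m + 1) = q ^ m * q" "q powr (a - b - 1) = z0" "q powr (- b) = 1 / B"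
    using q by (simp_all add: powr z0_def t_def B_def inverse_eq_divide)
  have conv6: "q powr ((a - b - real m - 1) * real M + (b - a + 1) * real r)
      = (z0 / q ^ m) ^ M * (B * q / t) ^ r"
  proof -
    have "q powr ((a - b - real m - 1) * real M) = (z0 / q ^ m) ^ M"
      using q by (simp only: powr_mult_nat) (simp add: powr z0_def t_def B_def mult_ac)
    moreover have "q powr ((b - a + 1) * real r) = (B * q / t) ^ r"
      using q by (simp add: powr t_def B_def)
    ultimately show ?thesis by (simp add: powr_add)
  qed
  \<comment> \<open>\<open>SL\<close> is the series arising from the scalar product and
    \<open>SR\<close> the one in \<open>qHahn_V\<close>; the transformation at z = B q^2/t connects
    them.\<close>
  define SL where "SL = (\<Sum>j\<le>N. qpoch (1 / q ^ M) q j * qpoch y q j * qpoch x q j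
        / (qpoch q q j * qpoch (1 / q ^ N) q j * qpoch e q j) * (B * q\<^sup>2 / t) ^ j)"
  define SR where "SR = (\<Sum>k\<le>m. qpoch (1 / q ^ m) q k * qpoch x q k * qpoch (B / q ^ M) q k
          / (qpoch q q k * qpoch (1 / q ^ N) q k * qpoch f q k) * (q\<^sup>2 / t) ^ k)"
  have SL: "SL = qpoch f q r / qpoch e q r * SR"
  proof -
    have "B * q\<^sup>2 / t / (B * q ^ r) = e" "B * q\<^sup>2 / t / B = q\<^sup>2 / t"
      using tB by (simp_all add: e_def)
    then show ?thesis
      using three_phi_two_transformation[OF q tB(2), of r M m "B * q\<^sup>2 / t"] nz N
      by (simp add: SL_def SR_def x_def y_def f_def e_def t_def B_def)
  qed
  have V: "qHahn_V m (real n) a b N q = qpoch (1 / q ^ N) q m / qpoch y q m * SR"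
    using qHahn_V_eq[OF q N] by (simp add: SR_def x_def y_def f_def t_def B_def)
  have cq: "c * q = e"
    by (simp add: c_def e_def power2_eq_square)
  have c1: "1 - c \<noteq> 0"
    using nz(1)[of 0] by (simp add: qpoch_Suc c_def t_def)
  define K where "K = z0 ^ M * qpoch q q M * qpoch (1 / q ^ N) q M
      / (qpoch (1 / q ^ M) q M * qpoch y q M) * (qpoch c q r / qpoch x q r * ((c - x) / (1 - c)))"
  have "vec_e_star q \<alpha> \<beta> N A ket m \<bullet> Z (vec_d q \<alpha> \<beta> N A ket n)
    = (\<Sum>l\<le>N. P n / P m * K * (qpoch (1 / q ^ M) q (N - l) * qpoch y q (N - l) * qpoch x q (N - l)
        / (qpoch q q (N - l) * qpoch (1 / q ^ N) q (N - l) * qpoch e q (N - l)) * (B * q\<^sup>2 / t) ^ (N - l)))"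
    unfolding vec_e_star_def vec_d_def shift inner P_def[symmetric]
  proof (rule sum.cong[OF refl])
    fix l assume "l \<in> {..N}"
    then have l: "l \<le> N" by simp
    define j where "j = N - l"
    have Pl: "P l \<noteq> 0" using A by (auto simp: P_def)
    define d where "d = (\<lambda>l. P n / P l * (qpoch x q (N - l) / qpoch x q r) * (qpoch c q r / qpoch c q (N - l)))"
    \<comment> \<open>At \<open>l = 0\<close> no shifted term exists. The uniform formula still
      holds, since there j + 1 = N + 1 exceeds \<open>r\<close> and (q^(-r);q)_(j+1) = 0.\<close>
    have "(if l = 0 then 0 else A (l - 1) * d (l - 1))
       = P n / P l * (qpoch c q r / qpoch x q r) * (qpoch x q (Suc j) / qpoch c q (Suc j))"
    proof (cases l)
      case 0
      then have "qpoch x q (Suc j) = 0"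
        using qpoch_inverse_power_eq_0[OF q(1), of r "Suc j"] N by (simp add: x_def j_def)
      with 0 show ?thesis by simp
    next
      case (Suc k)
      have "P k = A k * P l"
        using Suc l by (simp add: P_def prod.atLeast_Suc_lessThan)
      moreover have "N - k = Suc j" "A k \<noteq> 0"
        using Suc l A by (auto simp: j_def)
      ultimately show ?thesis using Suc by (simp add: d_def mult_ac)
    qed
    then have "- d l + (if l = 0 then 0 else A (l - 1) * d (l - 1))
       = P n / P l * (qpoch c q r / qpoch x q r)
         * (qpoch x q (Suc j) / qpoch c q (Suc j) - qpoch x q j / qpoch c q j)"
      by (simp add: d_def j_def right_diff_distrib)
    also have "qpoch x q (Suc j) / qpoch c q (Suc j) - qpoch x q j / qpoch c q j
       = (c - x) * q ^ j * qpoch x q j / ((1 - c) * qpoch e q j)"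
      unfolding x_def cq[symmetric]
      by (rule qpoch_ratio_shift[OF q(1)]) (use nz(1) in \<open>simp add: c_def t_def\<close>)
    finally have Zd: "- d l + (if l = 0 then 0 else A (l - 1) * d (l - 1))
       = P n / P l * (qpoch c q r / qpoch x q r) * ((c - x) * q ^ j * qpoch x q j / ((1 - c) * qpoch e q j))" .
    \<comment> \<open>The difference supplies q^j and e_m* supplies z0^(-j), which gives the series
      argument q/z0 = B q^2/t.\<close>
    have "(B * q\<^sup>2 / t) * z0 = q"
      using tB by (simp add: z0_def power2_eq_square)
    then have qj: "q ^ j = (B * q\<^sup>2 / t) ^ j * z0 ^ j"
      by (simp only: flip: power_mult_distrib)
    have nl: "real N - real l = real j" using l by (simp add: j_def)
    have "P l / P m * (z0 ^ M / z0 ^ j) * (qpoch (1 / q ^ M) q j / qpoch (1 / q ^ M) q M)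
        * (qpoch q q M / qpoch q q j) * (qpoch (1 / q ^ N) q M / qpoch (1 / q ^ N) q j)
        * (qpoch y q j / qpoch y q M) * (- d l + (if l = 0 then 0 else A (l - 1) * d (l - 1)))
      = P n / P m * K * (qpoch (1 / q ^ M) q j * qpoch y q j * qpoch x q j
        / (qpoch q q j * qpoch (1 / q ^ N) q j * qpoch e q j) * (B * q\<^sup>2 / t) ^ j)"
      unfolding Zd qj K_def using Pl tB by (simp add: mult_ac)
    then show "P l / P m * (q powr ((\<alpha> + \<beta> - real N) * (real N - real m))
         / q powr ((\<alpha> + \<beta> - real N) * (real N - real l)))
      * (qpoch (q powr (real m - real N)) q (N - l) / qpoch (q powr (real m - real N)) q (N - m))
      * (qpoch q q (N - m) / qpoch q q (N - l))
      * (qpoch (q powr (- real N)) q (N - m) / qpoch (q powr (- real N)) q (N - l))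
      * (qpoch (q powr (- real N - real m + 2 * \<beta> + 1)) q (N - l)
         / qpoch (q powr (- real N - real m + 2 * \<beta> + 1)) q (N - m))
      * (- (P n / P l
      * (qpoch (q powr (real n - real N)) q (N - l) / qpoch (q powr (real n - real N)) q (N - n))
      * (qpoch (q powr (real n - real N - \<alpha> + \<beta> + 1)) q (N - n)
         / qpoch (q powr (real n - real N - \<alpha> + \<beta> + 1)) q (N - l)))
       + (if l = 0 then 0 else A (l - 1) * (P n / P (l - 1)
      * (qpoch (q powr (real n - real N)) q (N - (l - 1)) / qpoch (q powr (real n - real N)) q (N - n))
      * (qpoch (q powr (real n - real N - \<alpha> + \<beta> + 1)) q (N - n)
         / qpoch (q powr (real n - real N - \<alpha> + \<beta> + 1)) q (N - (l - 1))))))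
      = P n / P m * K * (qpoch (1 / q ^ M) q (N - l) * qpoch y q (N - l) * qpoch x q (N - l)
        / (qpoch q q (N - l) * qpoch (1 / q ^ N) q (N - l) * qpoch e q (N - l)) * (B * q\<^sup>2 / t) ^ (N - l))"
      unfolding nl Nm conv1 conv2 conv3 conv4 d_def j_def[symmetric] .
  qed
  also have "\<dots> = P n / P m * (K * SL)"
    unfolding SL_def sum_distrib_left mult.assoc[of "P n / P m" K]
    by (rule sum.reindex_bij_witness[of _ "\<lambda>j. N - j" "\<lambda>j. N - j"]) auto
  also have "K * SL = - ((z0 / q ^ m) ^ M) * (B * q / t) ^ r
      * ((qpoch (q ^ m * q) q M * qpoch z0 q r)
         / (qpoch q q r * qpoch (1 / q ^ N) q m * qpoch_int (1 / B) q (int M - int m)))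
      * (qpoch (1 / q ^ N) q m / qpoch y q m * SR)"
  proof -
    have nN: "qpoch (1 / q ^ N) q m \<noteq> 0" "qpoch (1 / q ^ M) q M \<noteq> 0" "qpoch x q r \<noteq> 0"
      using qpoch_inverse_power_neq_0[OF q] N by (simp_all add: x_def)
    have e0: "qpoch e q r \<noteq> 0" using nz(3) by (simp add: e_def t_def)
    \<comment> \<open>Splitting (c;q)_(r+1) at its last and at its first factor relates (c;q)_r to
      (e;q)_r. Together with c - x = -x (1 - q/t), this produces the overall minus sign.\<close>
    have "c * q ^ r = q / t" using tB by (simp add: c_def)
    then have "qpoch c q r * (1 - q / t) = (1 - c) * qpoch e q r"
      using qpoch_Suc[of c q r] qpoch_Suc_left[of c q r] by (simp add: cq)
    moreover have "c - x = - (x * (1 - q / t))"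
      by (simp add: c_def x_def right_diff_distrib)
    ultimately have 1: "qpoch c q r * (c - x) = - x * ((1 - c) * qpoch e q r)"
      by (metis mult.left_commute mult_minus_left mult_minus_right)
    have "qpoch f q r * qpoch q q r = (B * q\<^sup>2 / t) ^ r * qpoch z0 q r * qpoch x q r"
      using qpoch_reverse[OF q(1), of "B * q\<^sup>2 / t" r] tB
      by (simp add: f_def x_def z0_def power2_eq_square)
    then have 2: "qpoch f q r / qpoch x q r = (B * q\<^sup>2 / t) ^ r * qpoch z0 q r / qpoch q q r"
      using nN nq[of r] by (subst frac_eq_eq) simp_all
    have "(B * q\<^sup>2 / t) * (1 / q) = B * q / t" using tB by (simp add: power2_eq_square)
    then have 3: "(B * q\<^sup>2 / t) ^ r * x = (B * q / t) ^ r"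
      by (simp only: x_def flip: power_mult_distrib power_one_over)
    have "qpoch (1 / q ^ N) q M * qpoch q q M
        = (1 / q ^ m) ^ M * qpoch (q ^ m * q) q M * qpoch (1 / q ^ M) q M"
      using qpoch_reverse[OF q(1), of "1 / q ^ m" M] tB
      by (simp add: N(1) power_add mult.commute)
    then have 4: "qpoch q q M * qpoch (1 / q ^ N) q M / qpoch (1 / q ^ M) q M
        = (1 / q ^ m) ^ M * qpoch (q ^ m * q) q M"
      using nN by (simp add: field_simps)
    have 5: "qpoch y q M = qpoch y q m * qpoch_int (1 / B) q (int M - int m)"
      using qpoch_int_split[OF q(1), of "1 / B" M m] nz(4) unfolding Nm conv5
      by (simp add: y_def mult.commute)
    have "K * SL = z0 ^ M * (qpoch q q M * qpoch (1 / q ^ N) q M / qpoch (1 / q ^ M) q M) / qpoch y q M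
      * (qpoch c q r * (c - x)) / ((1 - c) * qpoch e q r) * (qpoch f q r / qpoch x q r) * SR"
      unfolding SL K_def by (simp add: mult_ac)
    also have "\<dots> = - (z0 ^ M * (1 / q ^ m) ^ M) * ((B * q\<^sup>2 / t) ^ r * x)
      * (qpoch (q ^ m * q) q M * qpoch z0 q r) / (qpoch q q r * qpoch y q M) * SR"
      unfolding 1 2 4 using c1 e0 by (simp add: mult_ac)
    also have "z0 ^ M * (1 / q ^ m) ^ M = (z0 / q ^ m) ^ M"
      by (simp flip: power_mult_distrib)
    finally show ?thesis
      unfolding 3 5 using nN by (simp add: mult_ac)
  qed
  finally show ?thesis
    unfolding V conv6 Nm conv4 conv5 P_def by (simp add: mult_ac)
qed

text \<open>The two formulas are already available; what remains is to extract their nonvanishing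
  hypotheses from the assumed denominators.\<close>

theorem proposition7p1:
  fixes q \<alpha> \<beta> a b :: real
    and N :: nat
    and A :: "nat \<Rightarrow> real"
    and ket :: "nat \<Rightarrow> 'v::real_inner"
    and Z :: "'v \<Rightarrow> 'v"
  assumes q: "q > 0" "q \<noteq> 1"
    and N: "N > 0"
    and A: "\<And>i. i < N \<Longrightarrow> A i \<noteq> 0" "A N = 0"
    and orthonormal: "\<And>i j. i \<le> N \<Longrightarrow> j \<le> N \<Longrightarrow> ket i \<bullet> ket j = (if i = j then 1 else 0)"
    and basis: "span (ket ` {..N}) = UNIV"
    and Z: "linear Z"
      "\<And>n. n < N \<Longrightarrow> Z (ket n) = - ket n + A n *\<^sub>R ket (n + 1)"
      "Z (ket N) = - ket N"
    and a: "a = \<alpha> - \<beta>"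
    and b: "b = real N - 2 * \<beta> - 1"
    and vec_denominators: "vec_denominators_nonzero q \<alpha> \<beta> N"
    and U_denominators: "\<And>m n. m \<le> N \<Longrightarrow> n \<le> N \<Longrightarrow>
      qHahn_U_denominators_nonzero m (real n) a b q"
    and V_denominators: "\<And>m n. m \<le> N \<Longrightarrow> n \<le> N \<Longrightarrow>
      qHahn_U_denominators_nonzero m (real N - real n) (b - a + 2) b (inverse q)"
    and prefactor_denominators: "\<And>m. m \<le> N \<Longrightarrow>
        qpoch (q powr (real m + b - real N)) q m \<noteq> 0 \<and>
        qpoch_int (q powr (- b)) q (int N - 2 * int m) \<noteq> 0"
  shows "\<forall>m\<le>N. \<forall>n\<le>N.
    vec_e q \<alpha> \<beta> N A ket m \<bullet> vec_d_star q \<alpha> \<beta> N A ket n =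
      ((\<Prod>i<n. A i) / (\<Prod>i<m. A i))
      * q powr ((a + real m - real N - 1) * real m)
      * ((qpoch (q powr (1 - a)) q n * qpoch (q powr (1 + b)) q m)
         / (qpoch q q n * qpoch (q powr (real m + b - real N)) q m))
      * qHahn_U m (real n) a b N q
    \<and>
    vec_e_star q \<alpha> \<beta> N A ket m \<bullet> Z (vec_d q \<alpha> \<beta> N A ket n) =
      - ((\<Prod>i\<in>{n..<N}. A i) / (\<Prod>i\<in>{m..<N}. A i))
      * q powr ((a - b - real m - 1) * (real N - real m) + (b - a + 1) * (real N - real n))
      * ((qpoch (q powr (real m + 1)) q (N - m) * qpoch (q powr (a - b - 1)) q (N - n))
         / (qpoch q q (N - n) * qpoch (q powr (- real N)) q m
            * qpoch_int (q powr (- b)) q (int N - 2 * int m)))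
      * qHahn_V m (real n) a b N q"
proof (intro allI impI conjI)
  fix m n :: nat
  assume m: "m \<le> N" and n: "n \<le> N"
  define M where "M = N - m"
  define r where "r = N - n"
  have Nm: "N = M + m" and Nr: "N = n + r"
    using m n by (simp_all add: M_def r_def)
  have y: "qpoch (q powr (- real m - b)) q m \<noteq> 0"
    using U_denominators[OF m n] by (simp add: qHahn_U_denominators_nonzero_def)
  show "vec_e q \<alpha> \<beta> N A ket m \<bullet> vec_d_star q \<alpha> \<beta> N A ket n =
      ((\<Prod>i<n. A i) / (\<Prod>i<m. A i))
      * q powr ((a + real m - real N - 1) * real m)
      * ((qpoch (q powr (1 - a)) q n * qpoch (q powr (1 + b)) q m)
         / (qpoch q q n * qpoch (q powr (real m + b - real N)) q m))
      * qHahn_U m (real n) a b N q"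
    by (rule vec_e_inner_vec_d_star[OF q A(1) orthonormal a b m n y])
  define t where "t = q powr a"
  have t: "t \<noteq> 0" "q \<noteq> 0" using q by (simp_all add: t_def)
  \<comment> \<open>This is the denominator of |d_n> at n = N - k and l = 0, where the symbol has
    its full length \<open>N\<close>.\<close>
  have c: "q / t / q ^ k * q ^ i \<noteq> 1" if "k \<le> N" "i < N" for k i
  proof -
    have "real (N - k) - real N - \<alpha> + \<beta> + 1 = 1 - a - real k"
      using that by (simp add: a)
    then have "q powr (real (N - k) - real N - \<alpha> + \<beta> + 1) = q / t / q ^ k"
      using q by (simp only:) (simp add: powr_diff powr_realpow t_def)
    moreover have "qpoch (q powr (real (N - k) - real N - \<alpha> + \<beta> + 1)) q (N - 0) \<noteq> 0"
      using vec_denominators unfolding vec_denominators_nonzero_def by (metis diff_le_self le0)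
    ultimately show ?thesis
      using that by (simp add: qpoch_eq_0_iff)
  qed
  \<comment> \<open>The factor with index 0 exists because \<open>N > 0\<close>.\<close>
  have qt: "q / t \<noteq> 1"
    using c[of 0 0] N by simp
  \<comment> \<open>The index \<open>i = r = N\<close> lies outside the range of \<open>c\<close>;
    there the expression is q/t itself, covered by \<open>qt\<close>.\<close>
  have c': "qpoch (q / t / q ^ r) q (Suc j) \<noteq> 0" if "j \<le> r" for j
  proof -
    have "q / t / q ^ r * q ^ i \<noteq> 1" if "i \<le> r" for i
    proof (cases "i < N")
      case True
      then show ?thesis using c Nr by simp
    next
      case False
      with that Nr have "i = r" by simp
      then show ?thesis using qt q by simp
    qed
    with that show ?thesis by (auto simp: qpoch_eq_0_iff)
  qed
  \<comment> \<open>The parameter q^(2-a-r) is q^(1-a-k) with k = r - 1, so it belongs to the family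
    in \<open>c\<close>.\<close>
  have e: "qpoch (q\<^sup>2 / t / q ^ r) q r \<noteq> 0"
  proof (cases r)
    case (Suc k)
    then have "q\<^sup>2 / t / q ^ r = q / t / q ^ k"
      using q by (simp add: power2_eq_square)
    with Suc show ?thesis
      using c[of k] Nr by (auto simp: qpoch_eq_0_iff)
  qed simp
  \<comment> \<open>The condition for \<open>qHahn_V\<close> is taken at m = N, where its range of
    lengths includes \<open>r\<close>, and then carried from base q^(-1) to base
    \<open>q\<close>.\<close>
  have f: "qpoch (q powr b * q\<^sup>2 / t / q ^ r) q r \<noteq> 0"
  proof -
    have "q powr ((b - a + 2) - (real N - real n)) = q powr b * q\<^sup>2 / t / q ^ r"
      using q by (simp add: Nr powr_add powr_diff powr_realpow t_def)
    then have "inverse q powr ((b - a + 2) - (real N - real n)) = 1 / (q powr b * q\<^sup>2 / t / q ^ r)"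
      using q by (simp add: powr_divide inverse_eq_divide)
    then have "qpoch (1 / (q powr b * q\<^sup>2 / t / q ^ r)) (1 / q) r \<noteq> 0"
      using V_denominators[of N n] n Nr
      by (simp add: qHahn_U_denominators_nonzero_def inverse_eq_divide)
    then show ?thesis
      using qpoch_inverse_base[OF q(1), of "q powr b * q\<^sup>2 / t / q ^ r" r] t q by simp
  qed
  show "vec_e_star q \<alpha> \<beta> N A ket m \<bullet> Z (vec_d q \<alpha> \<beta> N A ket n) =
      - ((\<Prod>i\<in>{n..<N}. A i) / (\<Prod>i\<in>{m..<N}. A i))
      * q powr ((a - b - real m - 1) * (real N - real m) + (b - a + 1) * (real N - real n))
      * ((qpoch (q powr (real m + 1)) q (N - m) * qpoch (q powr (a - b - 1)) q (N - n))
         / (qpoch q q (N - n) * qpoch (q powr (- real N)) q m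
            * qpoch_int (q powr (- b)) q (int N - 2 * int m)))
      * qHahn_V m (real n) a b N q"
  proof (rule vec_e_star_inner_Z_vec_d[OF q A(1) orthonormal Z a b Nm Nr])
    show "qpoch_int (q powr - b) q (int N - 2 * int m) \<noteq> 0"
      using prefactor_denominators[OF m] by simp
  qed (use c' e f in \<open>simp_all add: t_def\<close>)
qed

end
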